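(* Let $(M,\alpha_M)$ and $(N,\alpha_N)$ be Hom-Lie algebras with compatible Hom-actions on each other. a) If $({}^NM,\alpha_{M|})$ is nilpotent, then so are $(M\star N,\alpha_{M\star N})$ and $({}^MN,\alpha_{N|})$. Furthermore, if $({}^NM,\alpha_{M|})$ is nilpotent of class $k$, then \[k\le \mathrm{ncl}(M\star N,\alpha_{M\star N})\le k+1\quad\text{and}\quad \mathrm{ncl}({}^MN,\alpha_{N|})\le k+1.\] b) Suppose that $\alpha_M$ and $\alpha_N$ are surjective, or that both $(M,\alpha_M)$ and $(N,\alpha_N)$ satisfy the weak $\alpha$-identity condition. If $({}^NM,\alpha_{M|})$ is solvable, then so are $(M\star N,\alpha_{M\star N})$ and $({}^MN,\alpha_{N|})$. Furthermore, if $({}^NM,\alpha_{M|})$ is solvable of class $k$, then \[k\le \mathrm{scl}(M\star N,\alpha_{M\star N})\le k+1\quad\text{and}\quad \mathrm{scl}({}^MN,\alpha_{N|})\le k+1.\] c) If $({}^NM,\alpha_{M|})$ is $k$-Engel, then $(M\star N,\alpha_{M\star N})$ and $({}^MN,\alpha_{N|})$ are $(k+1)$-Engel.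
   Context: Fix a ground field $\mathbb K$; all vector spaces and (bi)linear maps are over $\mathbb K$. A Hom-Lie algebra $(L,\alpha_L)$ is a vector space $L$ with a bilinear bracket and a linear map $\alpha_L:L\to L$ such that $[x,y]=-[y,x]$ and $[\alpha_L(x),[y,z]]+[\alpha_L(z),[x,y]]+[\alpha_L(y),[z,x]]=0$; all Hom-Lie algebras are assumed multiplicative: $\alpha_L[x,y]=[\alpha_L(x),\alpha_L(y)]$. A Hom-ideal of $(L,\alpha_L)$ is a subspace $H$ with $\alpha_L(H)\subseteq H$ and $[h,x]\in H$ for all $h\in H$, $x\in L$. For subspaces, $[H,K]$ is the span of all $[h,k]$. A series of length $k$ of $(Q,\alpha_Q)$ is a chain of Hom-ideals of $Q$, $0=M_0\subseteq M_1\subseteq\dots\subseteq M_k=Q$; it is central if $[Q,M_i]\subseteq M_{i-1}$ and abelian if $[M_i,M_i]\subseteq M_{i-1}$ for all $1\le i\le k$. $(Q,\alpha_Q)$ is nilpotent (resp. solvable) if it has a central (resp. abelian) series; the minimal length of such a series is its class of nilpotency $\mathrm{ncl}(Q)$ (resp. of solvability $\mathrm{scl}(Q)$). $(Q,\alpha_Q)$ satisfies the weak $\alpha$-identity condition if $[x,[y,z]]=[\alpha_Q(x),[y,z]]$ for all $x,y,z\in Q$. $(L,\alpha_L)$ is $k$-Engel if $R_x^k=0$ for all $x\in L$, where $R_x^k(y)=[\dots[[y,x],x],\dots,x]$ with $x$ occurring $k$ times. A Hom-action of $(L,\alpha_L)$ on $(M,\alpha_M)$ is a linear map $L\otimes M\to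 M$, $x\otimes m\mapsto {}^xm$, with ${}^{[x,y]}\alpha_M(m)={}^{\alpha_L(x)}({}^ym)-{}^{\alpha_L(y)}({}^xm)$, ${}^{\alpha_L(x)}[m,m']=[{}^xm,\alpha_M(m')]+[\alpha_M(m),{}^xm']$, $\alpha_M({}^xm)={}^{\alpha_L(x)}\alpha_M(m)$. Mutual Hom-actions of $(M,\alpha_M)$ and $(N,\alpha_N)$ are compatible if ${}^{({}^mn)}m'=[m',{}^nm]$ and ${}^{({}^nm)}n'=[n',{}^mn]$ for all $m,m'\in M$, $n,n'\in N$. In that case ${}^NM$ (resp. ${}^MN$) is the subspace of $M$ (resp. $N$) spanned by all ${}^nm$ (resp. ${}^mn$); these are Hom-ideals of $M$ and $N$, regarded as Hom-Lie algebras with the restricted endomorphisms $\alpha_{M|}$, $\alpha_{N|}$. For compatible mutual Hom-actions, the non-abelian tensor product $(M\star N,\alpha_{M\star N})$ is the quotient of the vector space $M\otimes N$ by the subspace spanned by all elements: (i) $[m,m']\otimes\alpha_N(n)-\alpha_M(m)\otimes{}^{m'}n+\alpha_M(m')\otimes{}^mn$; (ii) $\alpha_M(m)\otimes[n,n']-{}^{n'}m\otimes\alpha_N(n)+{}^nm\otimes\alpha_N(n')$; (iii) ${}^nm\otimes{}^mn$; (iv) ${}^nm\otimes{}^{m'}n'+{}^{n'}m'\otimes{}^mn$; (v) $[{}^nm,{}^{n'}m']\otimes\alpha_N({}^{m''}n'')+[{}^{n'}m',{}^{n''}m'']\otimes\alpha_N({}^mn)+[{}^{n''}m'',{}^nm]\otimes\alpha_N({}^{m'}n')$.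 The class of $m\otimes n$ is $m\star n$; the bracket is $[m\star n,m'\star n']=-{}^nm\star{}^{m'}n'$, and $\alpha_{M\star N}(m\star n)=\alpha_M(m)\star\alpha_N(n)$.
   Formalization: If the ground field has characteristic 2, the brackets of M and N are additionally assumed alternating ([x,x]=0); with only [x,y]=-[y,x] the bound k ≤ ncl(M⋆N) fails there. In other characteristics nothing is added. *)

theory Defs
  imports "HOL-Algebra.Module" "HOL-Algebra.AbelCoset"
begin

section \<open>Linear algebra over a field, in the carrier-based style of \<open>HOL-Algebra\<close>\<close>

text \<open>A vector space over the field \<open>K\<close> is a \<^locale>\<open>module\<close> over \<open>K\<close>; a subspace is a
  \<^locale>\<open>submodule\<close>. The ring components \<^const>\<open>mult\<close> and \<^const>\<open>one\<close> of a module record carry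
  no meaning.\<close>

definition subspace_span ::
  "('k, 'c) ring_scheme \<Rightarrow> ('k, 'a, 'd) module_scheme \<Rightarrow> 'a set \<Rightarrow> 'a set" where
  "subspace_span K V S = \<Inter> {H. submodule H K V \<and> S \<subseteq> H}"

definition linear_map ::
  "('k, 'c) ring_scheme \<Rightarrow> ('k, 'a, 'd) module_scheme \<Rightarrow> ('k, 'b, 'e) module_scheme
    \<Rightarrow> ('a \<Rightarrow> 'b) \<Rightarrow> bool" where
  "linear_map K V W f \<longleftrightarrow>
     f \<in> carrier V \<rightarrow> carrier W \<and>
     (\<forall>x\<in>carrier V. \<forall>y\<in>carrier V. f (x \<oplus>\<^bsub>V\<^esub> y) = f x \<oplus>\<^bsub>W\<^esub> f y) \<and>
     (\<forall>a\<in>carrier K. \<forall>x\<in>carrier V. f (a \<odot>\<^bsub>V\<^esub> x) = a \<odot>\<^bsub>W\<^esub> f x)"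

definition bilinear_map ::
  "('k, 'c) ring_scheme \<Rightarrow> ('k, 'a, 'd) module_scheme \<Rightarrow> ('k, 'b, 'e) module_scheme
    \<Rightarrow> ('k, 'w, 'f) module_scheme \<Rightarrow> ('a \<Rightarrow> 'b \<Rightarrow> 'w) \<Rightarrow> bool" where
  "bilinear_map K U V W f \<longleftrightarrow>
     (\<forall>x\<in>carrier U. linear_map K V W (f x)) \<and>
     (\<forall>y\<in>carrier V. linear_map K U W (\<lambda>x. f x y))"

definition quotient_space ::
  "('k, 'c) ring_scheme \<Rightarrow> ('k, 'a, 'd) module_scheme \<Rightarrow> 'a set \<Rightarrow> ('k, 'a set) module" where
  "quotient_space K V W =
     \<lparr> carrier = a_rcosets\<^bsub>V\<^esub> W,
       mult = undefined, one = undefined,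
       zero = W,
       add = (\<lambda>X Y. X <+>\<^bsub>V\<^esub> Y),
       smult = (\<lambda>a X. \<Union>x\<in>X. W +>\<^bsub>V\<^esub> (a \<odot>\<^bsub>V\<^esub> x)) \<rparr>"

text \<open>The vector space with basis \<open>X\<close>: finitely supported functions \<open>X \<rightarrow> K\<close>, extended by
  zero outside \<open>X\<close>.\<close>

definition free_space :: "('k, 'c) ring_scheme \<Rightarrow> 'x set \<Rightarrow> ('k, 'x \<Rightarrow> 'k) module" where
  "free_space K X =
     \<lparr> carrier = {u. range u \<subseteq> carrier K \<and> finite {x. u x \<noteq> \<zero>\<^bsub>K\<^esub>} \<and> {x. u x \<noteq> \<zero>\<^bsub>K\<^esub>} \<subseteq> X},
       mult = undefined, one = undefined,
       zero = (\<lambda>x. \<zero>\<^bsub>K\<^esub>),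
       add = (\<lambda>u v x. u x \<oplus>\<^bsub>K\<^esub> v x),
       smult = (\<lambda>a u x. a \<otimes>\<^bsub>K\<^esub> u x) \<rparr>"

definition basis_vector :: "('k, 'c) ring_scheme \<Rightarrow> 'x \<Rightarrow> 'x \<Rightarrow> 'k" where
  "basis_vector K x = (\<lambda>y. if y = x then \<one>\<^bsub>K\<^esub> else \<zero>\<^bsub>K\<^esub>)"

definition bilinearity_relations ::
  "('k, 'c) ring_scheme \<Rightarrow> ('k, 'a, 'd) module_scheme \<Rightarrow> ('k, 'b, 'e) module_scheme
    \<Rightarrow> ('a \<times> 'b \<Rightarrow> 'k) set" where
  "bilinearity_relations K V W =
    (let F = free_space K (carrier V \<times> carrier W); \<delta> = (\<lambda>v w. basis_vector K (v, w)) in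
      {\<delta> (v \<oplus>\<^bsub>V\<^esub> v') w \<ominus>\<^bsub>F\<^esub> (\<delta> v w \<oplus>\<^bsub>F\<^esub> \<delta> v' w) |v v' w.
         v \<in> carrier V \<and> v' \<in> carrier V \<and> w \<in> carrier W} \<union>
      {\<delta> v (w \<oplus>\<^bsub>W\<^esub> w') \<ominus>\<^bsub>F\<^esub> (\<delta> v w \<oplus>\<^bsub>F\<^esub> \<delta> v w') |v w w'.
         v \<in> carrier V \<and> w \<in> carrier W \<and> w' \<in> carrier W} \<union>
      {\<delta> (a \<odot>\<^bsub>V\<^esub> v) w \<ominus>\<^bsub>F\<^esub> (a \<odot>\<^bsub>F\<^esub> \<delta> v w) |a v w.
         a \<in> carrier K \<and> v \<in> carrier V \<and> w \<in> carrier W} \<union>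
      {\<delta> v (a \<odot>\<^bsub>W\<^esub> w) \<ominus>\<^bsub>F\<^esub> (a \<odot>\<^bsub>F\<^esub> \<delta> v w) |a v w.
         a \<in> carrier K \<and> v \<in> carrier V \<and> w \<in> carrier W})"

definition tensor_kernel ::
  "('k, 'c) ring_scheme \<Rightarrow> ('k, 'a, 'd) module_scheme \<Rightarrow> ('k, 'b, 'e) module_scheme
    \<Rightarrow> ('a \<times> 'b \<Rightarrow> 'k) set" where
  "tensor_kernel K V W =
     subspace_span K (free_space K (carrier V \<times> carrier W)) (bilinearity_relations K V W)"

definition tensor_space ::
  "('k, 'c) ring_scheme \<Rightarrow> ('k, 'a, 'd) module_scheme \<Rightarrow> ('k, 'b, 'e) module_scheme
    \<Rightarrow> ('k, ('a \<times> 'b \<Rightarrow> 'k) set) module" where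
  "tensor_space K V W =
     quotient_space K (free_space K (carrier V \<times> carrier W)) (tensor_kernel K V W)"

definition pure_tensor ::
  "('k, 'c) ring_scheme \<Rightarrow> ('k, 'a, 'd) module_scheme \<Rightarrow> ('k, 'b, 'e) module_scheme
    \<Rightarrow> 'a \<Rightarrow> 'b \<Rightarrow> ('a \<times> 'b \<Rightarrow> 'k) set" where
  "pure_tensor K V W v w =
     tensor_kernel K V W +>\<^bsub>free_space K (carrier V \<times> carrier W)\<^esub> basis_vector K (v, w)"


section \<open>Hom-Lie algebras\<close>

record ('k, 'a) hom_lie = "('k, 'a) module" +
  bracket :: "'a \<Rightarrow> 'a \<Rightarrow> 'a" (\<open>\<langle>_,_\<rangle>\<index>\<close>)
  twist :: "'a \<Rightarrow> 'a"

text \<open>Hom-Lie algebras are multiplicative throughout. The bracket is only required to be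
  skew-symmetric; this makes it alternating, except in characteristic 2, where the construction
  of the non-abelian tensor product needs \<open>alternating\<close> as a separate assumption.\<close>

locale hom_lie_algebra = K?: field K + L?: module K L
  for K :: "('k, 'c) ring_scheme" (structure) and L :: "('k, 'a, 'd) hom_lie_scheme" (structure) +
  assumes bracket_bilinear: "bilinear_map K L L L (bracket L)"
    and twist_linear: "linear_map K L L (twist L)"
    and bracket_skew:
      "\<lbrakk>x \<in> carrier L; y \<in> carrier L\<rbrakk> \<Longrightarrow> \<langle>x, y\<rangle>\<^bsub>L\<^esub> = \<ominus>\<^bsub>L\<^esub> \<langle>y, x\<rangle>\<^bsub>L\<^esub>"
    and hom_jacobi:
      "\<lbrakk>x \<in> carrier L; y \<in> carrier L; z \<in> carrier L\<rbrakk> \<Longrightarrow>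
        \<langle>twist L x, \<langle>y, z\<rangle>\<^bsub>L\<^esub>\<rangle>\<^bsub>L\<^esub> \<oplus>\<^bsub>L\<^esub> \<langle>twist L z, \<langle>x, y\<rangle>\<^bsub>L\<^esub>\<rangle>\<^bsub>L\<^esub>
          \<oplus>\<^bsub>L\<^esub> \<langle>twist L y, \<langle>z, x\<rangle>\<^bsub>L\<^esub>\<rangle>\<^bsub>L\<^esub> = \<zero>\<^bsub>L\<^esub>"
    and twist_bracket:
      "\<lbrakk>x \<in> carrier L; y \<in> carrier L\<rbrakk> \<Longrightarrow>
        twist L \<langle>x, y\<rangle>\<^bsub>L\<^esub> = \<langle>twist L x, twist L y\<rangle>\<^bsub>L\<^esub>"

definition alternating :: "('k, 'a, 'd) hom_lie_scheme \<Rightarrow> bool" where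
  "alternating L \<longleftrightarrow> (\<forall>x\<in>carrier L. \<langle>x, x\<rangle>\<^bsub>L\<^esub> = \<zero>\<^bsub>L\<^esub>)"

definition hom_ideal ::
  "('k, 'c) ring_scheme \<Rightarrow> ('k, 'a, 'd) hom_lie_scheme \<Rightarrow> 'a set \<Rightarrow> bool" where
  "hom_ideal K L H \<longleftrightarrow>
     submodule H K L \<and> twist L ` H \<subseteq> H \<and> (\<forall>h\<in>H. \<forall>x\<in>carrier L. \<langle>h, x\<rangle>\<^bsub>L\<^esub> \<in> H)"

definition commutator_space ::
  "('k, 'c) ring_scheme \<Rightarrow> ('k, 'a, 'd) hom_lie_scheme \<Rightarrow> 'a set \<Rightarrow> 'a set \<Rightarrow> 'a set" where
  "commutator_space K L A B = subspace_span K L {\<langle>x, y\<rangle>\<^bsub>L\<^esub> |x y. x \<in> A \<and> y \<in> B}"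

definition series ::
  "('k, 'c) ring_scheme \<Rightarrow> ('k, 'a, 'd) hom_lie_scheme \<Rightarrow> nat \<Rightarrow> (nat \<Rightarrow> 'a set) \<Rightarrow> bool" where
  "series K Q k S \<longleftrightarrow>
     S 0 = {\<zero>\<^bsub>Q\<^esub>} \<and> S k = carrier Q \<and>
     (\<forall>i\<le>k. hom_ideal K Q (S i)) \<and> (\<forall>i\<in>{1..k}. S (i - 1) \<subseteq> S i)"

definition central_series ::
  "('k, 'c) ring_scheme \<Rightarrow> ('k, 'a, 'd) hom_lie_scheme \<Rightarrow> nat \<Rightarrow> (nat \<Rightarrow> 'a set) \<Rightarrow> bool" where
  "central_series K Q k S \<longleftrightarrow>
     series K Q k S \<and> (\<forall>i\<in>{1..k}. commutator_space K Q (carrier Q) (S i) \<subseteq> S (i - 1))"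

definition abelian_series ::
  "('k, 'c) ring_scheme \<Rightarrow> ('k, 'a, 'd) hom_lie_scheme \<Rightarrow> nat \<Rightarrow> (nat \<Rightarrow> 'a set) \<Rightarrow> bool" where
  "abelian_series K Q k S \<longleftrightarrow>
     series K Q k S \<and> (\<forall>i\<in>{1..k}. commutator_space K Q (S i) (S i) \<subseteq> S (i - 1))"

definition nilpotent ::
  "('k, 'c) ring_scheme \<Rightarrow> ('k, 'a, 'd) hom_lie_scheme \<Rightarrow> bool" where
  "nilpotent K Q \<longleftrightarrow> (\<exists>k S. central_series K Q k S)"

definition ncl :: "('k, 'c) ring_scheme \<Rightarrow> ('k, 'a, 'd) hom_lie_scheme \<Rightarrow> nat" where
  "ncl K Q = (LEAST k. \<exists>S. central_series K Q k S)"

definition solvable ::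
  "('k, 'c) ring_scheme \<Rightarrow> ('k, 'a, 'd) hom_lie_scheme \<Rightarrow> bool" where
  "solvable K Q \<longleftrightarrow> (\<exists>k S. abelian_series K Q k S)"

definition scl :: "('k, 'c) ring_scheme \<Rightarrow> ('k, 'a, 'd) hom_lie_scheme \<Rightarrow> nat" where
  "scl K Q = (LEAST k. \<exists>S. abelian_series K Q k S)"

definition weak_alpha_identity :: "('k, 'a, 'd) hom_lie_scheme \<Rightarrow> bool" where
  "weak_alpha_identity Q \<longleftrightarrow>
     (\<forall>x\<in>carrier Q. \<forall>y\<in>carrier Q. \<forall>z\<in>carrier Q.
        \<langle>x, \<langle>y, z\<rangle>\<^bsub>Q\<^esub>\<rangle>\<^bsub>Q\<^esub> = \<langle>twist Q x, \<langle>y, z\<rangle>\<^bsub>Q\<^esub>\<rangle>\<^bsub>Q\<^esub>)"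

definition engel :: "nat \<Rightarrow> ('k, 'a, 'd) hom_lie_scheme \<Rightarrow> bool" where
  "engel k L \<longleftrightarrow>
     (\<forall>x\<in>carrier L. \<forall>y\<in>carrier L. ((\<lambda>z. \<langle>z, x\<rangle>\<^bsub>L\<^esub>) ^^ k) y = \<zero>\<^bsub>L\<^esub>)"


section \<open>Hom-actions and the non-abelian tensor product\<close>

definition hom_action ::
  "('k, 'c) ring_scheme \<Rightarrow> ('k, 'a, 'd) hom_lie_scheme \<Rightarrow> ('k, 'b, 'e) hom_lie_scheme
    \<Rightarrow> ('a \<Rightarrow> 'b \<Rightarrow> 'b) \<Rightarrow> bool" where
  "hom_action K L M act \<longleftrightarrow>
     bilinear_map K L M M act \<and>
     (\<forall>x\<in>carrier L. \<forall>y\<in>carrier L. \<forall>m\<in>carrier M.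
        act \<langle>x, y\<rangle>\<^bsub>L\<^esub> (twist M m) = act (twist L x) (act y m) \<ominus>\<^bsub>M\<^esub> act (twist L y) (act x m)) \<and>
     (\<forall>x\<in>carrier L. \<forall>m\<in>carrier M. \<forall>m'\<in>carrier M.
        act (twist L x) \<langle>m, m'\<rangle>\<^bsub>M\<^esub> =
          \<langle>act x m, twist M m'\<rangle>\<^bsub>M\<^esub> \<oplus>\<^bsub>M\<^esub> \<langle>twist M m, act x m'\<rangle>\<^bsub>M\<^esub>) \<and>
     (\<forall>x\<in>carrier L. \<forall>m\<in>carrier M. twist M (act x m) = act (twist L x) (twist M m))"

text \<open>In the sequel \<open>l n m\<close> is the action \<open>\<^sup>nm\<close> of \<open>N\<close> on \<open>M\<close>, and \<open>r m n\<close> is the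
  action \<open>\<^sup>mn\<close> of \<open>M\<close> on \<open>N\<close>.\<close>

definition compatible_actions ::
  "('k, 'a, 'd) hom_lie_scheme \<Rightarrow> ('k, 'b, 'e) hom_lie_scheme
    \<Rightarrow> ('b \<Rightarrow> 'a \<Rightarrow> 'a) \<Rightarrow> ('a \<Rightarrow> 'b \<Rightarrow> 'b) \<Rightarrow> bool" where
  "compatible_actions M N l r \<longleftrightarrow>
     (\<forall>m\<in>carrier M. \<forall>m'\<in>carrier M. \<forall>n\<in>carrier N. l (r m n) m' = \<langle>m', l n m\<rangle>\<^bsub>M\<^esub>) \<and>
     (\<forall>m\<in>carrier M. \<forall>n\<in>carrier N. \<forall>n'\<in>carrier N. r (l n m) n' = \<langle>n', r m n\<rangle>\<^bsub>N\<^esub>)"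

text \<open>For an action of \<open>L\<close> on \<open>M\<close>, the following is \<open>\<^sup>LM\<close> with the structure restricted
  from \<open>M\<close>.\<close>

definition action_ideal ::
  "('k, 'c) ring_scheme \<Rightarrow> ('k, 'a, 'd) hom_lie_scheme \<Rightarrow> ('k, 'b, 'e) hom_lie_scheme
    \<Rightarrow> ('a \<Rightarrow> 'b \<Rightarrow> 'b) \<Rightarrow> ('k, 'b, 'e) hom_lie_scheme" where
  "action_ideal K L M act =
     M\<lparr>carrier := subspace_span K M {act x m |x m. x \<in> carrier L \<and> m \<in> carrier M}\<rparr>"

definition star_relations ::
  "('k, 'c) ring_scheme \<Rightarrow> ('k, 'a, 'd) hom_lie_scheme \<Rightarrow> ('k, 'b, 'e) hom_lie_scheme
    \<Rightarrow> ('b \<Rightarrow> 'a \<Rightarrow> 'a) \<Rightarrow> ('a \<Rightarrow> 'b \<Rightarrow> 'b) \<Rightarrow> ('a \<times> 'b \<Rightarrow> 'k) set set" where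
  "star_relations K M N l r =
    (let T = tensor_space K M N; t = pure_tensor K M N; \<alpha> = twist M; \<beta> = twist N in
      {t \<langle>m, m'\<rangle>\<^bsub>M\<^esub> (\<beta> n) \<ominus>\<^bsub>T\<^esub> t (\<alpha> m) (r m' n) \<oplus>\<^bsub>T\<^esub> t (\<alpha> m') (r m n) |m m' n.
         m \<in> carrier M \<and> m' \<in> carrier M \<and> n \<in> carrier N} \<union>
      {t (\<alpha> m) \<langle>n, n'\<rangle>\<^bsub>N\<^esub> \<ominus>\<^bsub>T\<^esub> t (l n' m) (\<beta> n) \<oplus>\<^bsub>T\<^esub> t (l n m) (\<beta> n') |m n n'.
         m \<in> carrier M \<and> n \<in> carrier N \<and> n' \<in> carrier N} \<union>
      {t (l n m) (r m n) |m n. m \<in> carrier M \<and> n \<in> carrier N} \<union>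
      {t (l n m) (r m' n') \<oplus>\<^bsub>T\<^esub> t (l n' m') (r m n) |m m' n n'.
         m \<in> carrier M \<and> m' \<in> carrier M \<and> n \<in> carrier N \<and> n' \<in> carrier N} \<union>
      {t \<langle>l n m, l n' m'\<rangle>\<^bsub>M\<^esub> (\<beta> (r m'' n''))
         \<oplus>\<^bsub>T\<^esub> t \<langle>l n' m', l n'' m''\<rangle>\<^bsub>M\<^esub> (\<beta> (r m n))
         \<oplus>\<^bsub>T\<^esub> t \<langle>l n'' m'', l n m\<rangle>\<^bsub>M\<^esub> (\<beta> (r m' n')) |m m' m'' n n' n''.
         m \<in> carrier M \<and> m' \<in> carrier M \<and> m'' \<in> carrier M \<and>
         n \<in> carrier N \<and> n' \<in> carrier N \<and> n'' \<in> carrier N})"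

definition star_kernel ::
  "('k, 'c) ring_scheme \<Rightarrow> ('k, 'a, 'd) hom_lie_scheme \<Rightarrow> ('k, 'b, 'e) hom_lie_scheme
    \<Rightarrow> ('b \<Rightarrow> 'a \<Rightarrow> 'a) \<Rightarrow> ('a \<Rightarrow> 'b \<Rightarrow> 'b) \<Rightarrow> ('a \<times> 'b \<Rightarrow> 'k) set set" where
  "star_kernel K M N l r = subspace_span K (tensor_space K M N) (star_relations K M N l r)"

definition star_space ::
  "('k, 'c) ring_scheme \<Rightarrow> ('k, 'a, 'd) hom_lie_scheme \<Rightarrow> ('k, 'b, 'e) hom_lie_scheme
    \<Rightarrow> ('b \<Rightarrow> 'a \<Rightarrow> 'a) \<Rightarrow> ('a \<Rightarrow> 'b \<Rightarrow> 'b) \<Rightarrow> ('k, ('a \<times> 'b \<Rightarrow> 'k) set set) module" where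
  "star_space K M N l r = quotient_space K (tensor_space K M N) (star_kernel K M N l r)"

definition star ::
  "('k, 'c) ring_scheme \<Rightarrow> ('k, 'a, 'd) hom_lie_scheme \<Rightarrow> ('k, 'b, 'e) hom_lie_scheme
    \<Rightarrow> ('b \<Rightarrow> 'a \<Rightarrow> 'a) \<Rightarrow> ('a \<Rightarrow> 'b \<Rightarrow> 'b) \<Rightarrow> 'a \<Rightarrow> 'b \<Rightarrow> ('a \<times> 'b \<Rightarrow> 'k) set set" where
  "star K M N l r m n =
     star_kernel K M N l r +>\<^bsub>tensor_space K M N\<^esub> pure_tensor K M N m n"

text \<open>The bracket and the endomorphism of the tensor product are the (bi)linear maps with the
  prescribed values on the classes \<open>m \<star> n\<close>. Since these classes span, there is at most one
  such map on the carrier; existence is part of the theory of the tensor product.\<close>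

definition star_bracket ::
  "('k, 'c) ring_scheme \<Rightarrow> ('k, 'a, 'd) hom_lie_scheme \<Rightarrow> ('k, 'b, 'e) hom_lie_scheme
    \<Rightarrow> ('b \<Rightarrow> 'a \<Rightarrow> 'a) \<Rightarrow> ('a \<Rightarrow> 'b \<Rightarrow> 'b)
    \<Rightarrow> ('a \<times> 'b \<Rightarrow> 'k) set set \<Rightarrow> ('a \<times> 'b \<Rightarrow> 'k) set set \<Rightarrow> ('a \<times> 'b \<Rightarrow> 'k) set set" where
  "star_bracket K M N l r =
    (let T = star_space K M N l r; s = star K M N l r in
      SOME b. bilinear_map K T T T b \<and>
        (\<forall>m\<in>carrier M. \<forall>n\<in>carrier N. \<forall>m'\<in>carrier M. \<forall>n'\<in>carrier N.
           b (s m n) (s m' n') = \<ominus>\<^bsub>T\<^esub> s (l n m) (r m' n')))"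

definition star_twist ::
  "('k, 'c) ring_scheme \<Rightarrow> ('k, 'a, 'd) hom_lie_scheme \<Rightarrow> ('k, 'b, 'e) hom_lie_scheme
    \<Rightarrow> ('b \<Rightarrow> 'a \<Rightarrow> 'a) \<Rightarrow> ('a \<Rightarrow> 'b \<Rightarrow> 'b)
    \<Rightarrow> ('a \<times> 'b \<Rightarrow> 'k) set set \<Rightarrow> ('a \<times> 'b \<Rightarrow> 'k) set set" where
  "star_twist K M N l r =
    (let T = star_space K M N l r; s = star K M N l r in
      SOME f. linear_map K T T f \<and>
        (\<forall>m\<in>carrier M. \<forall>n\<in>carrier N. f (s m n) = s (twist M m) (twist N n)))"

definition star_product ::
  "('k, 'c) ring_scheme \<Rightarrow> ('k, 'a, 'd) hom_lie_scheme \<Rightarrow> ('k, 'b, 'e) hom_lie_scheme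
    \<Rightarrow> ('b \<Rightarrow> 'a \<Rightarrow> 'a) \<Rightarrow> ('a \<Rightarrow> 'b \<Rightarrow> 'b) \<Rightarrow> ('k, ('a \<times> 'b \<Rightarrow> 'k) set set) hom_lie" where
  "star_product K M N l r =
    (let T = star_space K M N l r in
      \<lparr> carrier = carrier T, mult = mult T, one = one T, zero = zero T, add = add T,
        smult = smult T,
        bracket = star_bracket K M N l r,
        twist = star_twist K M N l r \<rparr>)"

end

theory Submission
  imports Defs
begin

text \<open>The map \<open>m \<star> n \<mapsto> - \<^sup>nm\<close> extends to a morphism \<open>\<phi>\<close> from \<open>M \<star> N\<close> onto \<open>\<^sup>NM\<close>, and
  \<open>m \<star> n \<mapsto> \<^sup>mn\<close> extends to a morphism \<open>\<psi>\<close> onto \<open>\<^sup>MN\<close>. The bracket satisfies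
  \<open>[t, t'] = \<phi>(t) \<star> \<psi>(t')\<close>, so the kernel of \<open>\<phi>\<close> is central. Hence a central or abelian series of
  \<open>\<^sup>NM\<close> pulls back along \<open>\<phi>\<close> to one of \<open>M \<star> N\<close> that is longer by one, while images under \<open>\<phi>\<close> and
  \<open>\<psi>\<close> transport series of \<open>M \<star> N\<close> to \<open>\<^sup>NM\<close> and \<open>\<^sup>MN\<close>. The Engel condition is treated in the
  same way.\<close>

section \<open>Linear maps and spans\<close>

text \<open>The compatibility of the actions drives everything: acting by an element that is itself
  an action value is the same as bracketing. It turns the five families of relations into axioms
  about one algebra: of (i) and (ii), one becomes the derivation rule and the other the rule for
  acting by a bracket; (iii) becomes [x, x] = 0, (iv) skew-symmetry and (v) the Hom-Jacobi identity.
  The minus sign in \<phi> is forced: \<open>l (r m' n') (l n m)\<close> is the bracket of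
  \<open>l n m\<close> with \<open>l n' m'\<close>, while the bracket of the tensor product carries
  a minus.

  Bracket and endomorphism of the tensor product are specified only by their values on the classes
  of pure tensors, so their existence has to be shown. For the bracket the right-hand side \<phi>(t)
  \<star> \<psi>(t') does this by itself: it is bilinear as a composite of maps already lifted, so
  no map of two arguments has to descend through the quotient.

  That formula kills the kernel of \<phi> in the first argument only; relation (iv) supplies the
  skew-symmetry that covers the second.\<close>

locale linear = V?: module K V + W?: module K W
  for K :: "('k, 'c) ring_scheme" and V :: "('k, 'a, 'd) module_scheme"
    and W :: "('k, 'b, 'e) module_scheme" +
  fixes f :: "'a \<Rightarrow> 'b"
  assumes linear_map: "linear_map K V W f"
begin

lemma map_closed [simp, intro]: "x \<in> carrier V \<Longrightarrow> f x \<in> carrier W"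
  and map_add: "\<lbrakk>x \<in> carrier V; y \<in> carrier V\<rbrakk> \<Longrightarrow> f (x \<oplus>\<^bsub>V\<^esub> y) = f x \<oplus>\<^bsub>W\<^esub> f y"
  and map_smult: "\<lbrakk>a \<in> carrier K; x \<in> carrier V\<rbrakk> \<Longrightarrow> f (a \<odot>\<^bsub>V\<^esub> x) = a \<odot>\<^bsub>W\<^esub> f x"
  using linear_map by (auto simp: linear_map_def)

lemma map_zero: "f \<zero>\<^bsub>V\<^esub> = \<zero>\<^bsub>W\<^esub>"
  by (metis V.M.zero_closed V.R.zero_closed V.smult_l_null W.smult_l_null map_closed map_smult)

lemma map_minus: "x \<in> carrier V \<Longrightarrow> f (\<ominus>\<^bsub>V\<^esub> x) = \<ominus>\<^bsub>W\<^esub> f x"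
  by (metis V.M.a_inv_closed V.M.l_neg W.M.minus_equality map_add map_closed map_zero)

lemma map_diff: "\<lbrakk>x \<in> carrier V; y \<in> carrier V\<rbrakk> \<Longrightarrow> f (x \<ominus>\<^bsub>V\<^esub> y) = f x \<ominus>\<^bsub>W\<^esub> f y"
  by (simp add: a_minus_def map_add map_minus)

lemma preimage_submodule:
  assumes "submodule H K W"
  shows "submodule {x \<in> carrier V. f x \<in> H} K V"
proof -
  have "\<zero>\<^bsub>W\<^esub> \<in> H"
    using subgroup.one_closed[OF submodule.axioms(1)[OF assms]] by simp
  then show ?thesis
    using W.submoduleE[OF assms]
    by (intro V.submoduleI) (auto simp: map_zero map_minus map_add map_smult)
qed

lemma image_submodule:
  assumes "submodule H K V"
  shows "submodule (f ` H) K W"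
proof -
  note H = V.submoduleE[OF assms]
  have zero: "\<zero>\<^bsub>V\<^esub> \<in> H"
    using subgroup.one_closed[OF submodule.axioms(1)[OF assms]] by simp
  show ?thesis
  proof (rule W.submoduleI)
    show "f ` H \<subseteq> carrier W" using H(1) by auto
    show "\<zero>\<^bsub>W\<^esub> \<in> f ` H" using zero map_zero by (metis imageI)
  next
    fix a assume "a \<in> f ` H"
    then obtain x where "x \<in> H" "a = f x" by blast
    then have "\<ominus>\<^bsub>W\<^esub> a = f (\<ominus>\<^bsub>V\<^esub> x)" and "\<ominus>\<^bsub>V\<^esub> x \<in> H"
      using H(1,3) map_minus by auto
    then show "\<ominus>\<^bsub>W\<^esub> a \<in> f ` H" by blast
  next
    fix a b assume "a \<in> f ` H" "b \<in> f ` H"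
    then obtain x y where "x \<in> H" "a = f x" "y \<in> H" "b = f y" by blast
    then have "a \<oplus>\<^bsub>W\<^esub> b = f (x \<oplus>\<^bsub>V\<^esub> y)" and "x \<oplus>\<^bsub>V\<^esub> y \<in> H"
      using H(1,5) map_add by (auto simp: subset_iff)
    then show "a \<oplus>\<^bsub>W\<^esub> b \<in> f ` H" by blast
  next
    fix c a assume "c \<in> carrier K" "a \<in> f ` H"
    then obtain x where "c \<in> carrier K" "x \<in> H" "a = f x" by blast
    then have "c \<odot>\<^bsub>W\<^esub> a = f (c \<odot>\<^bsub>V\<^esub> x)" and "c \<odot>\<^bsub>V\<^esub> x \<in> H"
      using H(1,4) map_smult by (auto simp: subset_iff)
    then show "c \<odot>\<^bsub>W\<^esub> a \<in> f ` H" by blast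
  qed
qed

end

lemma linearI: "\<lbrakk>module K V; module K W; linear_map K V W f\<rbrakk> \<Longrightarrow> linear K V W f"
  by (simp add: linear_def linear_axioms_def)

lemma linear_mapI:
  assumes "\<And>x. x \<in> carrier V \<Longrightarrow> f x \<in> carrier W"
    and "\<And>x y. \<lbrakk>x \<in> carrier V; y \<in> carrier V\<rbrakk> \<Longrightarrow> f (x \<oplus>\<^bsub>V\<^esub> y) = f x \<oplus>\<^bsub>W\<^esub> f y"
    and "\<And>a x. \<lbrakk>a \<in> carrier K; x \<in> carrier V\<rbrakk> \<Longrightarrow> f (a \<odot>\<^bsub>V\<^esub> x) = a \<odot>\<^bsub>W\<^esub> f x"
  shows "linear_map K V W f"
  using assms by (auto simp: linear_map_def)

lemma linear_map_comp:
  assumes "linear_map K U V f" and "linear_map K V W g"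
  shows "linear_map K U W (\<lambda>x. g (f x))"
  using assms by (auto simp: linear_map_def Pi_iff)

lemma bilinear_map_linear_comp:
  assumes "bilinear_map K U V W f" and "linear_map K W Z g"
  shows "bilinear_map K U V Z (\<lambda>x y. g (f x y))"
  using assms by (auto simp: bilinear_map_def linear_map_def Pi_iff)

lemma (in module) linear_map_minus:
  assumes "linear_map R U M f"
  shows "linear_map R U M (\<lambda>x. \<ominus>\<^bsub>M\<^esub> f x)"
  using assms by (auto simp: linear_map_def Pi_iff minus_add smult_r_minus)

lemma bilinear_mapD:
  assumes "bilinear_map K U V W f"
  shows "x \<in> carrier U \<Longrightarrow> linear_map K V W (f x)"
    and "y \<in> carrier V \<Longrightarrow> linear_map K U W (\<lambda>x. f x y)"
  using assms by (auto simp: bilinear_map_def)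

lemma bilinear_map_compose:
  assumes "bilinear_map K U V W f" and "linear_map K U' U g" and "linear_map K V' V h"
  shows "bilinear_map K U' V' W (\<lambda>x y. f (g x) (h y))"
  using assms by (auto simp: bilinear_map_def linear_map_def Pi_iff)

lemma (in module) bilinear_map_minus:
  assumes "bilinear_map R U V M f"
  shows "bilinear_map R U V M (\<lambda>x y. \<ominus>\<^bsub>M\<^esub> f x y)"
  using assms unfolding bilinear_map_def by (auto intro: linear_map_minus)

context module
begin

lemma zero_submodule: "submodule {\<zero>\<^bsub>M\<^esub>} R M"
  by (rule submoduleI) auto

lemma span_submodule:
  assumes "S \<subseteq> carrier M"
  shows "submodule (subspace_span R M S) R M"
  unfolding subspace_span_def
proof (rule submoduleI)
  show "\<Inter> {H. submodule H R M \<and> S \<subseteq> H} \<subseteq> carrier M"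
    using assms carrier_is_submodule by blast
  show "\<zero>\<^bsub>M\<^esub> \<in> \<Inter> {H. submodule H R M \<and> S \<subseteq> H}"
    using subgroup.one_closed[OF submodule.axioms(1)] by fastforce
qed (auto intro: submoduleE(3-5))

lemma span_superset: "S \<subseteq> subspace_span R M S"
  by (auto simp: subspace_span_def)

lemma span_minimal: "\<lbrakk>submodule H R M; S \<subseteq> H\<rbrakk> \<Longrightarrow> subspace_span R M S \<subseteq> H"
  by (auto simp: subspace_span_def)

end

text \<open>A subspace contains a span as soon as it contains the generators. Conditions on series
  can thus be tested on single brackets, and read off from a given series in the same way.\<close>

lemma commutator_space_subset_iff:
  assumes "submodule H K L"
  shows "commutator_space K L A B \<subseteq> H \<longleftrightarrow> (\<forall>x\<in>A. \<forall>y\<in>B. \<langle>x, y\<rangle>\<^bsub>L\<^esub> \<in> H)"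
  using assms by (force simp: commutator_space_def subspace_span_def)

lemma (in linear) vanishes_on_span:
  assumes "S \<subseteq> carrier V" and "\<And>x. x \<in> S \<Longrightarrow> f x = \<zero>\<^bsub>W\<^esub>" and "x \<in> subspace_span K V S"
  shows "f x = \<zero>\<^bsub>W\<^esub>"
proof -
  have "subspace_span K V S \<subseteq> {x \<in> carrier V. f x \<in> {\<zero>\<^bsub>W\<^esub>}}"
    using assms by (intro V.span_minimal preimage_submodule W.zero_submodule) auto
  with assms(3) show ?thesis by blast
qed

lemma (in linear) image_span:
  assumes "S \<subseteq> carrier V"
  shows "f ` subspace_span K V S = subspace_span K W (f ` S)"
proof
  have fS: "f ` S \<subseteq> carrier W" using assms by auto
  have "subspace_span K V S \<subseteq> {x \<in> carrier V. f x \<in> subspace_span K W (f ` S)}"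
    by (rule V.span_minimal[OF preimage_submodule[OF W.span_submodule[OF fS]]])
      (use assms W.span_superset[of "f ` S"] in auto)
  then show "f ` subspace_span K V S \<subseteq> subspace_span K W (f ` S)" by auto
  show "subspace_span K W (f ` S) \<subseteq> f ` subspace_span K V S"
    by (rule W.span_minimal[OF image_submodule[OF V.span_submodule[OF assms]]])
      (use V.span_superset[of S] in blast)
qed

text \<open>The set where two linear maps agree is a subspace. This is the uniqueness principle
  behind every identity that is later checked only on classes \<open>s m n\<close>.\<close>

lemma linear_eq_on_span:
  assumes "linear K V W f" and "linear K V W g"
    and span: "carrier V \<subseteq> subspace_span K V S" and "S \<subseteq> carrier V"
    and eq: "\<And>x. x \<in> S \<Longrightarrow> f x = g x" and x: "x \<in> carrier V"
  shows "f x = g x"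
proof -
  interpret f: linear K V W f by fact
  interpret g: linear K V W g by fact
  have "submodule {x \<in> carrier V. f x = g x} K V"
    by (rule f.V.submoduleI)
      (auto simp: f.map_zero g.map_zero f.map_minus g.map_minus f.map_add g.map_add
        f.map_smult g.map_smult)
  moreover have "S \<subseteq> {x \<in> carrier V. f x = g x}"
    using assms by auto
  ultimately have "subspace_span K V S \<subseteq> {x \<in> carrier V. f x = g x}"
    by (rule f.V.span_minimal)
  with span x show ?thesis by blast
qed

section \<open>Free spaces\<close>

context cring
begin

lemma free_space_module: "module R (free_space R X)"
proof -
  let ?F = "free_space R X"
  have carrier: "u \<in> carrier ?F \<longleftrightarrow>
      (\<forall>x. u x \<in> carrier R) \<and> finite {x. u x \<noteq> \<zero>} \<and> {x. u x \<noteq> \<zero>} \<subseteq> X" for u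
    by (auto simp: free_space_def)
  have add: "u \<oplus>\<^bsub>?F\<^esub> v \<in> carrier ?F" if "u \<in> carrier ?F" "v \<in> carrier ?F" for u v
  proof -
    have "{x. u x \<oplus> v x \<noteq> \<zero>} \<subseteq> {x. u x \<noteq> \<zero>} \<union> {x. v x \<noteq> \<zero>}" by auto
    then show ?thesis
      using that unfolding carrier
      by (auto simp: free_space_def intro: finite_subset)
  qed
  have smult: "a \<odot>\<^bsub>?F\<^esub> u \<in> carrier ?F" if "a \<in> carrier R" "u \<in> carrier ?F" for a u
  proof -
    have "{x. a \<otimes> u x \<noteq> \<zero>} \<subseteq> {x. u x \<noteq> \<zero>}" using that by auto
    then show ?thesis
      using that unfolding carrier
      by (auto simp: free_space_def intro: finite_subset)
  qed
  have closed: "u x \<in> carrier R" if "u \<in> carrier ?F" for u x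
    using that by (simp add: carrier)
  have zero: "\<zero>\<^bsub>?F\<^esub> \<in> carrier ?F"
    by (simp add: carrier) (simp add: free_space_def)
  have app: "(u \<oplus>\<^bsub>?F\<^esub> v) x = u x \<oplus> v x" "(a \<odot>\<^bsub>?F\<^esub> u) x = a \<otimes> u x" "\<zero>\<^bsub>?F\<^esub> x = \<zero>" for a u v x
    by (simp_all add: free_space_def)
  have "abelian_group ?F"
  proof (rule abelian_groupI)
    fix u assume u: "u \<in> carrier ?F"
    \<comment> \<open>Scaling by -1 supplies the additive inverse, whose existence is all that
      \<open>abelian_groupI\<close> asks for.\<close>
    have "(\<ominus> \<one>) \<odot>\<^bsub>?F\<^esub> u \<oplus>\<^bsub>?F\<^esub> u = \<zero>\<^bsub>?F\<^esub>"
      by (rule ext) (simp add: app closed[OF u] l_minus l_neg)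
    then show "\<exists>v\<in>carrier ?F. v \<oplus>\<^bsub>?F\<^esub> u = \<zero>\<^bsub>?F\<^esub>"
      using smult[OF _ u, of "\<ominus> \<one>"] by auto
  next
    fix u v w assume u: "u \<in> carrier ?F" and v: "v \<in> carrier ?F" and w: "w \<in> carrier ?F"
    show "u \<oplus>\<^bsub>?F\<^esub> v \<oplus>\<^bsub>?F\<^esub> w = u \<oplus>\<^bsub>?F\<^esub> (v \<oplus>\<^bsub>?F\<^esub> w)"
      by (rule ext) (simp add: app closed[OF u] closed[OF v] closed[OF w] a_assoc)
  next
    fix u v assume u: "u \<in> carrier ?F" and v: "v \<in> carrier ?F"
    show "u \<oplus>\<^bsub>?F\<^esub> v = v \<oplus>\<^bsub>?F\<^esub> u"
      by (rule ext) (simp add: app closed[OF u] closed[OF v] a_comm)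
  next
    fix u assume u: "u \<in> carrier ?F"
    show "\<zero>\<^bsub>?F\<^esub> \<oplus>\<^bsub>?F\<^esub> u = u"
      by (rule ext) (simp add: app closed[OF u])
  qed (rule add zero; assumption?)+
  then show ?thesis
  proof (rule moduleI[OF is_cring])
    fix a b u assume a: "a \<in> carrier R" and b: "b \<in> carrier R" and u: "u \<in> carrier ?F"
    show "(a \<oplus> b) \<odot>\<^bsub>?F\<^esub> u = a \<odot>\<^bsub>?F\<^esub> u \<oplus>\<^bsub>?F\<^esub> b \<odot>\<^bsub>?F\<^esub> u"
      by (rule ext) (simp add: app closed[OF u] a b l_distr)
    show "(a \<otimes> b) \<odot>\<^bsub>?F\<^esub> u = a \<odot>\<^bsub>?F\<^esub> (b \<odot>\<^bsub>?F\<^esub> u)"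
      by (rule ext) (simp add: app closed[OF u] a b m_assoc)
  next
    fix a u v assume a: "a \<in> carrier R" and u: "u \<in> carrier ?F" and v: "v \<in> carrier ?F"
    show "a \<odot>\<^bsub>?F\<^esub> (u \<oplus>\<^bsub>?F\<^esub> v) = a \<odot>\<^bsub>?F\<^esub> u \<oplus>\<^bsub>?F\<^esub> a \<odot>\<^bsub>?F\<^esub> v"
      by (rule ext) (simp add: app closed[OF u] closed[OF v] a r_distr)
  next
    fix u assume u: "u \<in> carrier ?F"
    show "\<one> \<odot>\<^bsub>?F\<^esub> u = u"
      by (rule ext) (simp add: app closed[OF u])
  qed (rule smult)
qed

lemma free_space_carrierD:
  assumes "u \<in> carrier (free_space R X)"
  shows "u x \<in> carrier R" "finite {x. u x \<noteq> \<zero>}" "{x. u x \<noteq> \<zero>} \<subseteq> X"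
  using assms by (auto simp: free_space_def)

lemma basis_vector_closed: "x \<in> X \<Longrightarrow> basis_vector R x \<in> carrier (free_space R X)"
  by (auto simp: free_space_def basis_vector_def)

lemma free_space_span:
  "carrier (free_space R X) \<subseteq> subspace_span R (free_space R X) (basis_vector R ` X)"
proof
  let ?F = "free_space R X"
  let ?H = "subspace_span R ?F (basis_vector R ` X)"
  interpret F: module R ?F by (rule free_space_module)
  have H: "submodule ?H R ?F"
    by (rule F.span_submodule) (auto intro: basis_vector_closed)
  \<comment> \<open>The induction runs over any finite set \<open>A\<close> containing the support,
    so that clearing the coordinate \<open>y\<close> of \<open>u\<close> leaves a vector supported
    in the smaller set.\<close>
  have main: "u \<in> ?H" if "finite A" "u \<in> carrier ?F" "{x. u x \<noteq> \<zero>} \<subseteq> A" for A u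
    using that
  proof (induction A arbitrary: u)
    case empty
    then have "u = \<zero>\<^bsub>?F\<^esub>" by (auto simp: free_space_def)
    then show ?case
      using subgroup.one_closed[OF submodule.axioms(1)[OF H]] by simp
  next
    case (insert y A)
    note u = free_space_carrierD[OF insert.prems(1)]
    show ?case
    proof (cases "u y = \<zero>")
      case True
      then show ?thesis using insert by blast
    next
      case False
      then have y: "y \<in> X" using u(3) by blast
      let ?v = "u(y := \<zero>)"
      have v: "?v \<in> carrier ?F"
        using u by (auto simp: free_space_def intro: finite_subset[OF _ u(2)])
      have vH: "?v \<in> ?H"
        by (rule insert.IH[OF v]) (use insert.prems(2) in auto)
      have bH: "basis_vector R y \<in> ?H"
        using F.span_superset y by blast
      have "u = ?v \<oplus>\<^bsub>?F\<^esub> (u y \<odot>\<^bsub>?F\<^esub> basis_vector R y)"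
        using u(1) by (auto simp: free_space_def basis_vector_def fun_eq_iff)
      also have "\<dots> \<in> ?H"
        using F.submoduleE(4,5)[OF H] u(1) vH bH by blast
      finally show ?thesis .
    qed
  qed
  show "u \<in> ?H" if "u \<in> carrier ?F" for u
    by (rule main[OF free_space_carrierD(2)[OF that] that order_refl])
qed

end

text \<open>Universal property of a basis: \<open>u\<close> is sent to the combination of the
  \<open>g x\<close> with coefficients \<open>u x\<close>, a finite sum over the support of
  \<open>u\<close>.\<close>

lemma (in module) free_space_lift:
  assumes g: "g \<in> X \<rightarrow> carrier M"
  obtains f where "linear_map R (free_space R X) M f"
    and "\<And>x. x \<in> X \<Longrightarrow> f (basis_vector R x) = g x"
proof -
  let ?F = "free_space R X"
  define f where "f u = (\<Oplus>\<^bsub>M\<^esub>x\<in>{x. u x \<noteq> \<zero>\<^bsub>R\<^esub>}. u x \<odot>\<^bsub>M\<^esub> g x)" for u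
  have term_closed: "u x \<odot>\<^bsub>M\<^esub> g x \<in> carrier M" if "u \<in> carrier ?F" "x \<in> X" for u x
    using R.free_space_carrierD(1)[OF that(1)] g that(2) by (auto simp: Pi_iff)
  \<comment> \<open>Supports may shrink under addition and scaling, so sums over the exact supports
    do not match termwise. Padding with zero terms allows a common finite index set.\<close>
  have f_eq: "f u = (\<Oplus>\<^bsub>M\<^esub>x\<in>A. u x \<odot>\<^bsub>M\<^esub> g x)"
    if "u \<in> carrier ?F" "finite A" "{x. u x \<noteq> \<zero>\<^bsub>R\<^esub>} \<subseteq> A" "A \<subseteq> X" for u A
    unfolding f_def
    by (rule M.add.finprod_mono_neutral_cong_left)
      (use that g term_closed[OF that(1)] in \<open>auto simp: Pi_iff subset_iff\<close>)
  have "linear_map R ?F M f"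
  proof (rule linear_mapI)
    fix u assume u: "u \<in> carrier ?F"
    show "f u \<in> carrier M"
      unfolding f_def by (rule M.finsum_closed)
        (use term_closed[OF u] R.free_space_carrierD(3)[OF u] in \<open>auto simp: Pi_iff\<close>)
  next
    fix u v assume u: "u \<in> carrier ?F" and v: "v \<in> carrier ?F"
    let ?A = "{x. u x \<noteq> \<zero>\<^bsub>R\<^esub>} \<union> {x. v x \<noteq> \<zero>\<^bsub>R\<^esub>}"
    note uD = R.free_space_carrierD[OF u] and vD = R.free_space_carrierD[OF v]
    interpret F: module R ?F by (rule R.free_space_module)
    have A: "finite ?A" "?A \<subseteq> X" using uD vD by auto
    have app: "(u \<oplus>\<^bsub>?F\<^esub> v) x = u x \<oplus>\<^bsub>R\<^esub> v x" for x by (simp add: free_space_def)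
    have "f (u \<oplus>\<^bsub>?F\<^esub> v) = (\<Oplus>\<^bsub>M\<^esub>x\<in>?A. (u \<oplus>\<^bsub>?F\<^esub> v) x \<odot>\<^bsub>M\<^esub> g x)"
      by (rule f_eq) (use u v A in \<open>auto simp: app\<close>)
    also have "\<dots> = (\<Oplus>\<^bsub>M\<^esub>x\<in>?A. u x \<odot>\<^bsub>M\<^esub> g x \<oplus>\<^bsub>M\<^esub> v x \<odot>\<^bsub>M\<^esub> g x)"
      by (rule M.finsum_cong')
        (use A g uD vD term_closed[OF u] term_closed[OF v] in \<open>auto simp: app Pi_iff intro!: smult_l_distr\<close>)
    also have "\<dots> = (\<Oplus>\<^bsub>M\<^esub>x\<in>?A. u x \<odot>\<^bsub>M\<^esub> g x) \<oplus>\<^bsub>M\<^esub> (\<Oplus>\<^bsub>M\<^esub>x\<in>?A. v x \<odot>\<^bsub>M\<^esub> g x)"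
      by (rule M.finsum_addf) (use A(2) term_closed[OF u] term_closed[OF v] in \<open>auto simp: Pi_iff\<close>)
    also have "\<dots> = f u \<oplus>\<^bsub>M\<^esub> f v"
      using f_eq[OF u A(1) _ A(2)] f_eq[OF v A(1) _ A(2)] by simp
    finally show "f (u \<oplus>\<^bsub>?F\<^esub> v) = f u \<oplus>\<^bsub>M\<^esub> f v" .
  next
    fix a u assume a: "a \<in> carrier R" and u: "u \<in> carrier ?F"
    let ?A = "{x. u x \<noteq> \<zero>\<^bsub>R\<^esub>}"
    note uD = R.free_space_carrierD[OF u]
    interpret F: module R ?F by (rule R.free_space_module)
    have app: "(a \<odot>\<^bsub>?F\<^esub> u) x = a \<otimes>\<^bsub>R\<^esub> u x" for x by (simp add: free_space_def)
    have "f (a \<odot>\<^bsub>?F\<^esub> u) = (\<Oplus>\<^bsub>M\<^esub>x\<in>?A. (a \<odot>\<^bsub>?F\<^esub> u) x \<odot>\<^bsub>M\<^esub> g x)"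
      by (rule f_eq) (use a u uD in \<open>auto simp: app\<close>)
    also have "\<dots> = (\<Oplus>\<^bsub>M\<^esub>x\<in>?A. a \<odot>\<^bsub>M\<^esub> (u x \<odot>\<^bsub>M\<^esub> g x))"
      by (rule M.finsum_cong')
        (use a g uD term_closed[OF u] in \<open>auto simp: app Pi_iff intro!: smult_assoc1\<close>)
    also have "\<dots> = a \<odot>\<^bsub>M\<^esub> f u"
      unfolding f_def
      by (rule finsum_smult_ldistr[symmetric]) (use a uD(2,3) term_closed[OF u] in \<open>auto simp: Pi_iff\<close>)
    finally show "f (a \<odot>\<^bsub>?F\<^esub> u) = a \<odot>\<^bsub>M\<^esub> f u" .
  qed
  moreover have "f (basis_vector R x) = g x" if "x \<in> X" for x
  proof -
    have "f (basis_vector R x) = (\<Oplus>\<^bsub>M\<^esub>y\<in>{x}. basis_vector R x y \<odot>\<^bsub>M\<^esub> g y)"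
      by (rule f_eq) (use that R.basis_vector_closed in \<open>auto simp: basis_vector_def split: if_splits\<close>)
    also have "\<dots> = g x"
      using that g by (subst M.finsum_insert) (auto simp: basis_vector_def Pi_iff)
    finally show ?thesis .
  qed
  ultimately show ?thesis by (rule that)
qed

section \<open>Quotient spaces\<close>

context module
begin

context
  fixes H assumes H: "submodule H R M"
begin

interpretation H: abelian_subgroup H M
  by (rule abelian_subgroupI3)
    (use H M.abelian_group_axioms in \<open>auto simp: additive_subgroup_def dest: submodule.axioms(1)\<close>)

lemma quotient_coset_eq_iff:
  assumes "x \<in> carrier M" "y \<in> carrier M"
  shows "H +>\<^bsub>M\<^esub> x = H +>\<^bsub>M\<^esub> y \<longleftrightarrow> x \<ominus>\<^bsub>M\<^esub> y \<in> H"
  using assms H.a_rcos_module[OF assms(2,1)] H.a_rcos_self[OF assms(1)]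
    M.a_repr_independence[OF _ assms(2) H.a_subgroup]
  by (auto simp: a_minus_def)

lemma quotient_carrier: "carrier (quotient_space R M H) = (\<lambda>x. H +>\<^bsub>M\<^esub> x) ` carrier M"
  by (auto simp: quotient_space_def A_RCOSETS_def')

lemma quotient_closed: "x \<in> carrier M \<Longrightarrow> H +>\<^bsub>M\<^esub> x \<in> carrier (quotient_space R M H)"
  by (simp add: quotient_carrier)

lemma quotient_coset_cases:
  assumes "X \<in> carrier (quotient_space R M H)"
  obtains x where "x \<in> carrier M" "X = H +>\<^bsub>M\<^esub> x"
  using assms by (auto simp: quotient_carrier)

lemma quotient_add:
  assumes "x \<in> carrier M" "y \<in> carrier M"
  shows "(H +>\<^bsub>M\<^esub> x) \<oplus>\<^bsub>quotient_space R M H\<^esub> (H +>\<^bsub>M\<^esub> y) = H +>\<^bsub>M\<^esub> (x \<oplus>\<^bsub>M\<^esub> y)"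
  using assms by (simp add: quotient_space_def H.a_rcos_sum)

text \<open>\<open>quotient_space\<close> takes a union over all representatives. If
  \<open>y\<close> and \<open>x\<close> differ by an element of \<open>H\<close>, so do their
  multiples by \<open>a\<close>, and hence all cosets in that union coincide.\<close>

lemma quotient_smult:
  assumes a: "a \<in> carrier R" and x: "x \<in> carrier M"
  shows "a \<odot>\<^bsub>quotient_space R M H\<^esub> (H +>\<^bsub>M\<^esub> x) = H +>\<^bsub>M\<^esub> (a \<odot>\<^bsub>M\<^esub> x)"
proof -
  have "H +>\<^bsub>M\<^esub> (a \<odot>\<^bsub>M\<^esub> y) = H +>\<^bsub>M\<^esub> (a \<odot>\<^bsub>M\<^esub> x)" if y: "y \<in> H +>\<^bsub>M\<^esub> x" for y
  proof -
    have yc: "y \<in> carrier M" using x y H.a_elemrcos_carrier by blast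
    have "y \<ominus>\<^bsub>M\<^esub> x \<in> H" using x y yc H.a_rcos_module by (simp add: a_minus_def)
    then have "a \<odot>\<^bsub>M\<^esub> (y \<ominus>\<^bsub>M\<^esub> x) \<in> H" using submoduleE(4)[OF H] a by blast
    then have "a \<odot>\<^bsub>M\<^esub> y \<ominus>\<^bsub>M\<^esub> a \<odot>\<^bsub>M\<^esub> x \<in> H"
      using a x yc by (simp add: a_minus_def smult_r_distr smult_r_minus)
    then show ?thesis using a x yc by (simp add: quotient_coset_eq_iff)
  qed
  moreover have "x \<in> H +>\<^bsub>M\<^esub> x" using x by (rule H.a_rcos_self)
  ultimately have "(\<Union>y\<in>H +>\<^bsub>M\<^esub> x. H +>\<^bsub>M\<^esub> (a \<odot>\<^bsub>M\<^esub> y)) = H +>\<^bsub>M\<^esub> (a \<odot>\<^bsub>M\<^esub> x)"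
    by blast
  then show ?thesis by (simp add: quotient_space_def)
qed

lemma quotient_zero: "\<zero>\<^bsub>quotient_space R M H\<^esub> = H +>\<^bsub>M\<^esub> \<zero>\<^bsub>M\<^esub>"
  using H.a_subset by (simp add: quotient_space_def)

lemma quotient_module: "module R (quotient_space R M H)"
proof -
  let ?Q = "quotient_space R M H"
  have "abelian_group ?Q"
  proof (rule abelian_groupI)
    fix X assume "X \<in> carrier ?Q"
    then obtain x where "x \<in> carrier M" "X = H +>\<^bsub>M\<^esub> x"
      by (auto simp: quotient_carrier)
    then show "\<exists>Y\<in>carrier ?Q. Y \<oplus>\<^bsub>?Q\<^esub> X = \<zero>\<^bsub>?Q\<^esub>"
      by (intro bexI[of _ "H +>\<^bsub>M\<^esub> (\<ominus>\<^bsub>M\<^esub> x)"])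
        (auto simp: quotient_carrier quotient_add quotient_zero M.l_neg)
  qed (auto simp: quotient_carrier quotient_add quotient_zero M.a_ac)
  then show ?thesis
    by (rule moduleI[OF R.is_cring]; elim quotient_coset_cases)
      (simp_all add: quotient_closed quotient_add quotient_smult smult_l_distr smult_r_distr smult_assoc1)
qed

lemma quotient_map_linear: "linear_map R M (quotient_space R M H) (\<lambda>x. H +>\<^bsub>M\<^esub> x)"
  by (rule linear_mapI) (simp_all add: quotient_closed quotient_add quotient_smult)

lemma quotient_map_kernel: "x \<in> H \<Longrightarrow> H +>\<^bsub>M\<^esub> x = \<zero>\<^bsub>quotient_space R M H\<^esub>"
  using H.a_rcos_const by (simp add: quotient_space_def)

lemma quotient_span:
  assumes "carrier M \<subseteq> subspace_span R M S" and S: "S \<subseteq> carrier M"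
  shows "carrier (quotient_space R M H)
    \<subseteq> subspace_span R (quotient_space R M H) ((\<lambda>x. H +>\<^bsub>M\<^esub> x) ` S)"
proof -
  let ?Q = "quotient_space R M H" and ?p = "\<lambda>x. H +>\<^bsub>M\<^esub> x"
  interpret p: linear R M ?Q ?p
    using quotient_module quotient_map_linear module_axioms
    by (simp add: linear_def linear_axioms_def)
  have sub: "submodule (subspace_span R ?Q (?p ` S)) R ?Q"
    by (rule p.W.span_submodule) (use S in blast)
  have "subspace_span R M S \<subseteq> {x \<in> carrier M. ?p x \<in> subspace_span R ?Q (?p ` S)}"
    by (rule span_minimal[OF p.preimage_submodule[OF sub]])
      (use S p.W.span_superset[of "?p ` S"] in blast)
  with assms show ?thesis by (auto simp: quotient_carrier)
qed

text \<open>Representatives of one coset differ by an element of \<open>H\<close>, where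
  \<open>f\<close> vanishes; hence the representative picked by \<open>SOME\<close> does not affect
  the value of \<open>g\<close>.\<close>

lemma quotient_lift:
  assumes "linear R M W f" and ker: "\<And>x. x \<in> H \<Longrightarrow> f x = \<zero>\<^bsub>W\<^esub>"
  obtains g where "linear_map R (quotient_space R M H) W g"
    and "\<And>x. x \<in> carrier M \<Longrightarrow> g (H +>\<^bsub>M\<^esub> x) = f x"
proof -
  interpret f: linear R M W f by fact
  have wd: "f x = f y" if "x \<in> carrier M" "y \<in> carrier M" "H +>\<^bsub>M\<^esub> x = H +>\<^bsub>M\<^esub> y" for x y
  proof -
    have "x \<ominus>\<^bsub>M\<^esub> y \<in> H" using that by (simp add: quotient_coset_eq_iff)
    then have "f (x \<ominus>\<^bsub>M\<^esub> y) \<oplus>\<^bsub>W\<^esub> f y = f y" using ker that by simp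
    then have "f (x \<ominus>\<^bsub>M\<^esub> y \<oplus>\<^bsub>M\<^esub> y) = f y" using f.map_add that by simp
    then show ?thesis using that by (simp add: a_minus_def M.a_assoc M.l_neg)
  qed
  define g where "g X = f (SOME x. x \<in> carrier M \<and> H +>\<^bsub>M\<^esub> x = X)" for X
  have g: "g (H +>\<^bsub>M\<^esub> x) = f x" if "x \<in> carrier M" for x
    unfolding g_def
  proof (rule someI2[of _ x])
    show "x \<in> carrier M \<and> H +>\<^bsub>M\<^esub> x = H +>\<^bsub>M\<^esub> x" using that by simp
  qed (use that wd in blast)
  have "linear_map R (quotient_space R M H) W g"
    by (rule linear_mapI; elim quotient_coset_cases)
      (simp_all add: quotient_add quotient_smult g f.map_add f.map_smult)
  then show ?thesis using g by (rule that)
qed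

end

end

section \<open>Tensor products\<close>

locale module_pair = V?: module K V + W?: module K W
  for K :: "('k, 'c) ring_scheme" and V :: "('k, 'a, 'd) module_scheme"
    and W :: "('k, 'b, 'e) module_scheme"
begin

abbreviation "tensor_free \<equiv> free_space K (carrier V \<times> carrier W)"

sublocale F: module K tensor_free
  by (rule V.R.free_space_module)

lemma delta_closed:
  "\<lbrakk>v \<in> carrier V; w \<in> carrier W\<rbrakk> \<Longrightarrow> basis_vector K (v, w) \<in> carrier tensor_free"
  by (rule V.R.basis_vector_closed) simp

lemma bilinearity_relations_closed: "bilinearity_relations K V W \<subseteq> carrier tensor_free"
  by (auto simp: bilinearity_relations_def Let_def delta_closed)

lemma bilinearity_relations_memI:
  "\<lbrakk>v \<in> carrier V; v' \<in> carrier V; w \<in> carrier W\<rbrakk> \<Longrightarrow>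
    basis_vector K (v \<oplus>\<^bsub>V\<^esub> v', w) \<ominus>\<^bsub>tensor_free\<^esub>
      (basis_vector K (v, w) \<oplus>\<^bsub>tensor_free\<^esub> basis_vector K (v', w)) \<in> bilinearity_relations K V W"
  "\<lbrakk>v \<in> carrier V; w \<in> carrier W; w' \<in> carrier W\<rbrakk> \<Longrightarrow>
    basis_vector K (v, w \<oplus>\<^bsub>W\<^esub> w') \<ominus>\<^bsub>tensor_free\<^esub>
      (basis_vector K (v, w) \<oplus>\<^bsub>tensor_free\<^esub> basis_vector K (v, w')) \<in> bilinearity_relations K V W"
  "\<lbrakk>a \<in> carrier K; v \<in> carrier V; w \<in> carrier W\<rbrakk> \<Longrightarrow>
    basis_vector K (a \<odot>\<^bsub>V\<^esub> v, w) \<ominus>\<^bsub>tensor_free\<^esub>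
      (a \<odot>\<^bsub>tensor_free\<^esub> basis_vector K (v, w)) \<in> bilinearity_relations K V W"
  "\<lbrakk>a \<in> carrier K; v \<in> carrier V; w \<in> carrier W\<rbrakk> \<Longrightarrow>
    basis_vector K (v, a \<odot>\<^bsub>W\<^esub> w) \<ominus>\<^bsub>tensor_free\<^esub>
      (a \<odot>\<^bsub>tensor_free\<^esub> basis_vector K (v, w)) \<in> bilinearity_relations K V W"
  unfolding bilinearity_relations_def Let_def by blast+

lemma tensor_kernel_submodule: "submodule (tensor_kernel K V W) K tensor_free"
  unfolding tensor_kernel_def by (rule F.span_submodule[OF bilinearity_relations_closed])

lemma tensor_space_module: "module K (tensor_space K V W)"
  unfolding tensor_space_def by (rule F.quotient_module[OF tensor_kernel_submodule])

lemma pure_tensor_bilinear: "bilinear_map K V W (tensor_space K V W) (pure_tensor K V W)"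
proof -
  let ?p = "\<lambda>x. tensor_kernel K V W +>\<^bsub>tensor_free\<^esub> x" and ?\<delta> = "\<lambda>v w. basis_vector K (v, w)"
  let ?T = "tensor_space K V W"
  note H = tensor_kernel_submodule
  \<comment> \<open>The generators of \<open>tensor_kernel\<close> are differences, so each of the
    four families of relations is one equality of cosets.\<close>
  have rel: "?p x = ?p y"
    if "x \<ominus>\<^bsub>tensor_free\<^esub> y \<in> bilinearity_relations K V W"
      "x \<in> carrier tensor_free" "y \<in> carrier tensor_free" for x y
    using subsetD[OF F.span_superset that(1)] F.quotient_coset_eq_iff[OF H that(2,3)]
    by (simp add: tensor_kernel_def)
  note pure = pure_tensor_def tensor_space_def
  have "linear_map K W ?T (pure_tensor K V W v)" if v: "v \<in> carrier V" for v
  proof (rule linear_mapI)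
    show "pure_tensor K V W v w \<in> carrier ?T" if "w \<in> carrier W" for w
      unfolding pure by (rule F.quotient_closed[OF H delta_closed[OF v that]])
  next
    fix w w' assume w: "w \<in> carrier W" "w' \<in> carrier W"
    have "?p (?\<delta> v (w \<oplus>\<^bsub>W\<^esub> w')) = ?p (?\<delta> v w \<oplus>\<^bsub>tensor_free\<^esub> ?\<delta> v w')"
      by (rule rel) (use v w in \<open>simp_all add: bilinearity_relations_memI delta_closed\<close>)
    then show "pure_tensor K V W v (w \<oplus>\<^bsub>W\<^esub> w') =
        pure_tensor K V W v w \<oplus>\<^bsub>?T\<^esub> pure_tensor K V W v w'"
      using v w by (simp add: pure F.quotient_add[OF H] delta_closed)
  next
    fix a w assume w: "a \<in> carrier K" "w \<in> carrier W"
    have "?p (?\<delta> v (a \<odot>\<^bsub>W\<^esub> w)) = ?p (a \<odot>\<^bsub>tensor_free\<^esub> ?\<delta> v w)"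
      by (rule rel) (use v w in \<open>simp_all add: bilinearity_relations_memI delta_closed\<close>)
    then show "pure_tensor K V W v (a \<odot>\<^bsub>W\<^esub> w) = a \<odot>\<^bsub>?T\<^esub> pure_tensor K V W v w"
      using v w by (simp add: pure F.quotient_smult[OF H] delta_closed)
  qed
  moreover have "linear_map K V ?T (\<lambda>v. pure_tensor K V W v w)" if w: "w \<in> carrier W" for w
  proof (rule linear_mapI)
    show "pure_tensor K V W v w \<in> carrier ?T" if "v \<in> carrier V" for v
      unfolding pure by (rule F.quotient_closed[OF H delta_closed[OF that w]])
  next
    fix v v' assume v: "v \<in> carrier V" "v' \<in> carrier V"
    have "?p (?\<delta> (v \<oplus>\<^bsub>V\<^esub> v') w) = ?p (?\<delta> v w \<oplus>\<^bsub>tensor_free\<^esub> ?\<delta> v' w)"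
      by (rule rel) (use v w in \<open>simp_all add: bilinearity_relations_memI delta_closed\<close>)
    then show "pure_tensor K V W (v \<oplus>\<^bsub>V\<^esub> v') w =
        pure_tensor K V W v w \<oplus>\<^bsub>?T\<^esub> pure_tensor K V W v' w"
      using v w by (simp add: pure F.quotient_add[OF H] delta_closed)
  next
    fix a v assume v: "a \<in> carrier K" "v \<in> carrier V"
    have "?p (?\<delta> (a \<odot>\<^bsub>V\<^esub> v) w) = ?p (a \<odot>\<^bsub>tensor_free\<^esub> ?\<delta> v w)"
      by (rule rel) (use v w in \<open>simp_all add: bilinearity_relations_memI delta_closed\<close>)
    then show "pure_tensor K V W (a \<odot>\<^bsub>V\<^esub> v) w = a \<odot>\<^bsub>?T\<^esub> pure_tensor K V W v w"
      using v w by (simp add: pure F.quotient_smult[OF H] delta_closed)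
  qed
  ultimately show ?thesis by (simp add: bilinear_map_def)
qed

lemma tensor_span:
  "carrier (tensor_space K V W) \<subseteq> subspace_span K (tensor_space K V W)
     {pure_tensor K V W v w |v w. v \<in> carrier V \<and> w \<in> carrier W}"
proof -
  have eq: "(\<lambda>x. tensor_kernel K V W +>\<^bsub>tensor_free\<^esub> x) ` basis_vector K ` (carrier V \<times> carrier W) =
      {pure_tensor K V W v w |v w. v \<in> carrier V \<and> w \<in> carrier W}"
    by (auto simp: pure_tensor_def)
  have sub: "basis_vector K ` (carrier V \<times> carrier W) \<subseteq> carrier tensor_free"
    by (auto intro: delta_closed)
  show ?thesis
    using F.quotient_span[OF tensor_kernel_submodule V.R.free_space_span sub]
    unfolding eq tensor_space_def .
qed

text \<open>Universal property of the tensor product: \<open>f\<close> extends from the basis of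
  pairs to the free space, and bilinearity of \<open>f\<close> says that the extension vanishes on
  the relations.\<close>

lemma tensor_lift:
  assumes U: "module K U" and f: "bilinear_map K V W U f"
  obtains g where "linear_map K (tensor_space K V W) U g"
    and "\<And>v w. \<lbrakk>v \<in> carrier V; w \<in> carrier W\<rbrakk> \<Longrightarrow> g (pure_tensor K V W v w) = f v w"
proof -
  interpret U: module K U by (rule U)
  note fl = bilinear_mapD[OF f]
  have f_closed: "f v w \<in> carrier U" if "v \<in> carrier V" "w \<in> carrier W" for v w
    using fl(1)[OF that(1)] that(2) by (auto simp: linear_map_def)
  obtain h where h: "linear_map K tensor_free U h"
    and h_delta: "\<And>x. x \<in> carrier V \<times> carrier W \<Longrightarrow> h (basis_vector K x) = case_prod f x"
    by (rule U.free_space_lift[of "case_prod f" "carrier V \<times> carrier W"])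
      (use f_closed in auto)
  interpret h: linear K tensor_free U h
    by (intro linear.intro linear_axioms.intro F.module_axioms U h)
  have "h x = \<zero>\<^bsub>U\<^esub>" if "x \<in> bilinearity_relations K V W" for x
    using that fl f_closed unfolding bilinearity_relations_def Let_def
    by (auto simp: h.map_minus h.map_add h.map_smult delta_closed h_delta linear_map_def
        U.M.r_neg a_minus_def)
  then have "h x = \<zero>\<^bsub>U\<^esub>" if "x \<in> tensor_kernel K V W" for x
    using that h.vanishes_on_span[OF bilinearity_relations_closed] by (simp add: tensor_kernel_def)
  then obtain g where g_linear: "linear_map K (tensor_space K V W) U g"
    and g: "\<And>x. x \<in> carrier tensor_free \<Longrightarrow> g (tensor_kernel K V W +>\<^bsub>tensor_free\<^esub> x) = h x"
    using F.quotient_lift[OF tensor_kernel_submodule h.linear_axioms] tensor_space_def by metis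
  have "g (pure_tensor K V W v w) = f v w" if "v \<in> carrier V" "w \<in> carrier W" for v w
    using that by (simp add: pure_tensor_def g delta_closed h_delta)
  with g_linear show ?thesis by (rule that)
qed

end

section \<open>Compatible Hom-actions and the non-abelian tensor product\<close>

context hom_lie_algebra
begin

lemma bracket_closed [simp, intro]:
  "\<lbrakk>x \<in> carrier L; y \<in> carrier L\<rbrakk> \<Longrightarrow> \<langle>x, y\<rangle>\<^bsub>L\<^esub> \<in> carrier L"
  using bracket_bilinear by (auto simp: bilinear_map_def linear_map_def)

lemma twist_closed [simp, intro]: "x \<in> carrier L \<Longrightarrow> twist L x \<in> carrier L"
  using twist_linear by (auto simp: linear_map_def)

lemma bracket_minus_right:
  assumes "x \<in> carrier L" "y \<in> carrier L"
  shows "\<langle>x, \<ominus>\<^bsub>L\<^esub> y\<rangle>\<^bsub>L\<^esub> = \<ominus>\<^bsub>L\<^esub> \<langle>x, y\<rangle>\<^bsub>L\<^esub>"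
proof -
  interpret ad: linear K L L "bracket L x"
    by (rule linearI[OF module_axioms module_axioms bilinear_mapD(1)[OF bracket_bilinear assms(1)]])
  show ?thesis using ad.map_minus[OF assms(2)] .
qed

text \<open>Skew-symmetry at y = x gives 2 [x, x] = 0, and 2 is a unit of the field unless it is
  zero; in the latter case the assumption takes over.\<close>

lemma bracket_self:
  assumes "\<one> \<oplus> \<one> = \<zero> \<Longrightarrow> alternating L" and x: "x \<in> carrier L"
  shows "\<langle>x, x\<rangle>\<^bsub>L\<^esub> = \<zero>\<^bsub>L\<^esub>"
proof (cases "\<one> \<oplus> \<one> = \<zero>")
  case True
  then show ?thesis using assms by (simp add: alternating_def)
next
  case False
  let ?y = "\<langle>x, x\<rangle>\<^bsub>L\<^esub>" and ?two = "\<one> \<oplus> \<one>"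
  have y: "?y \<in> carrier L" using x by simp
  have two: "?two \<in> Units K" using False by (simp add: field_Units)
  have "?two \<odot>\<^bsub>L\<^esub> ?y = ?y \<oplus>\<^bsub>L\<^esub> ?y"
    using y smult_l_distr[of \<one> \<one> ?y] by simp
  also have "\<dots> = ?y \<oplus>\<^bsub>L\<^esub> \<ominus>\<^bsub>L\<^esub> ?y"
    using bracket_skew[OF x x] by simp
  also have "\<dots> = \<zero>\<^bsub>L\<^esub>"
    using y by (rule L.M.r_neg)
  finally have "(inv ?two \<otimes> ?two) \<odot>\<^bsub>L\<^esub> ?y = inv ?two \<odot>\<^bsub>L\<^esub> \<zero>\<^bsub>L\<^esub>"
    using two y by (simp only: smult_assoc1 K.Units_inv_closed K.Units_closed)
  then show ?thesis using two y by (simp only: K.Units_l_inv smult_one K.Units_inv_closed smult_r_null)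
qed

end

locale compatible_pair =
  M?: hom_lie_algebra K M + N?: hom_lie_algebra K N
  for K :: "('k, 'c) ring_scheme"
    and M :: "('k, 'a, 'd) hom_lie_scheme" and N :: "('k, 'b, 'e) hom_lie_scheme" +
  fixes l :: "'b \<Rightarrow> 'a \<Rightarrow> 'a" and r :: "'a \<Rightarrow> 'b \<Rightarrow> 'b"
  assumes char2: "\<one>\<^bsub>K\<^esub> \<oplus>\<^bsub>K\<^esub> \<one>\<^bsub>K\<^esub> = \<zero>\<^bsub>K\<^esub> \<Longrightarrow> alternating M \<and> alternating N"
    and l_action: "hom_action K N M l" and r_action: "hom_action K M N r"
    and compatible: "compatible_actions M N l r"
begin

sublocale tensor: module_pair K M N
  by (intro module_pair.intro M.L.module_axioms N.L.module_axioms)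

text \<open>The identities (i)--(v) that a bilinear map on \<open>M \<times> N\<close> has to satisfy to factor through
  \<open>M \<star> N\<close>.\<close>

definition star_map :: "('k, 'u, 'f) module_scheme \<Rightarrow> ('a \<Rightarrow> 'b \<Rightarrow> 'u) \<Rightarrow> bool" where
  "star_map U f \<longleftrightarrow> bilinear_map K M N U f \<and>
    (\<forall>m\<in>carrier M. \<forall>m'\<in>carrier M. \<forall>n\<in>carrier N.
      f \<langle>m, m'\<rangle>\<^bsub>M\<^esub> (twist N n) \<ominus>\<^bsub>U\<^esub> f (twist M m) (r m' n) \<oplus>\<^bsub>U\<^esub> f (twist M m') (r m n) = \<zero>\<^bsub>U\<^esub>) \<and>
    (\<forall>m\<in>carrier M. \<forall>n\<in>carrier N. \<forall>n'\<in>carrier N.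
      f (twist M m) \<langle>n, n'\<rangle>\<^bsub>N\<^esub> \<ominus>\<^bsub>U\<^esub> f (l n' m) (twist N n) \<oplus>\<^bsub>U\<^esub> f (l n m) (twist N n') = \<zero>\<^bsub>U\<^esub>) \<and>
    (\<forall>m\<in>carrier M. \<forall>n\<in>carrier N. f (l n m) (r m n) = \<zero>\<^bsub>U\<^esub>) \<and>
    (\<forall>m\<in>carrier M. \<forall>m'\<in>carrier M. \<forall>n\<in>carrier N. \<forall>n'\<in>carrier N.
      f (l n m) (r m' n') \<oplus>\<^bsub>U\<^esub> f (l n' m') (r m n) = \<zero>\<^bsub>U\<^esub>) \<and>
    (\<forall>m\<in>carrier M. \<forall>m'\<in>carrier M. \<forall>m''\<in>carrier M.
      \<forall>n\<in>carrier N. \<forall>n'\<in>carrier N. \<forall>n''\<in>carrier N.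
      f \<langle>l n m, l n' m'\<rangle>\<^bsub>M\<^esub> (twist N (r m'' n''))
        \<oplus>\<^bsub>U\<^esub> f \<langle>l n' m', l n'' m''\<rangle>\<^bsub>M\<^esub> (twist N (r m n))
        \<oplus>\<^bsub>U\<^esub> f \<langle>l n'' m'', l n m\<rangle>\<^bsub>M\<^esub> (twist N (r m' n')) = \<zero>\<^bsub>U\<^esub>)"

abbreviation "X \<equiv> tensor_space K M N"
abbreviation "pt \<equiv> pure_tensor K M N"
abbreviation "T \<equiv> star_space K M N l r"
abbreviation "s \<equiv> star K M N l r"

lemma l_bilinear: "bilinear_map K N M M l"
  using l_action by (simp add: hom_action_def)

lemma r_bilinear: "bilinear_map K M N N r"
  using r_action by (simp add: hom_action_def)

lemma l_closed [simp]: "\<lbrakk>n \<in> carrier N; m \<in> carrier M\<rbrakk> \<Longrightarrow> l n m \<in> carrier M"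
  using l_bilinear by (auto simp: bilinear_map_def linear_map_def)

lemma r_closed [simp]: "\<lbrakk>m \<in> carrier M; n \<in> carrier N\<rbrakk> \<Longrightarrow> r m n \<in> carrier N"
  using r_bilinear by (auto simp: bilinear_map_def linear_map_def)

lemma l_bracket: "\<lbrakk>n \<in> carrier N; n' \<in> carrier N; m \<in> carrier M\<rbrakk> \<Longrightarrow>
    l \<langle>n, n'\<rangle>\<^bsub>N\<^esub> (twist M m) = l (twist N n) (l n' m) \<ominus>\<^bsub>M\<^esub> l (twist N n') (l n m)"
  and l_derivation: "\<lbrakk>n \<in> carrier N; m \<in> carrier M; m' \<in> carrier M\<rbrakk> \<Longrightarrow>
    l (twist N n) \<langle>m, m'\<rangle>\<^bsub>M\<^esub> = \<langle>l n m, twist M m'\<rangle>\<^bsub>M\<^esub> \<oplus>\<^bsub>M\<^esub> \<langle>twist M m, l n m'\<rangle>\<^bsub>M\<^esub>"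
  and twist_l: "\<lbrakk>n \<in> carrier N; m \<in> carrier M\<rbrakk> \<Longrightarrow> twist M (l n m) = l (twist N n) (twist M m)"
  using l_action by (simp_all add: hom_action_def)

lemma r_bracket: "\<lbrakk>m \<in> carrier M; m' \<in> carrier M; n \<in> carrier N\<rbrakk> \<Longrightarrow>
    r \<langle>m, m'\<rangle>\<^bsub>M\<^esub> (twist N n) = r (twist M m) (r m' n) \<ominus>\<^bsub>N\<^esub> r (twist M m') (r m n)"
  and r_derivation: "\<lbrakk>m \<in> carrier M; n \<in> carrier N; n' \<in> carrier N\<rbrakk> \<Longrightarrow>
    r (twist M m) \<langle>n, n'\<rangle>\<^bsub>N\<^esub> = \<langle>r m n, twist N n'\<rangle>\<^bsub>N\<^esub> \<oplus>\<^bsub>N\<^esub> \<langle>twist N n, r m n'\<rangle>\<^bsub>N\<^esub>"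
  and twist_r: "\<lbrakk>m \<in> carrier M; n \<in> carrier N\<rbrakk> \<Longrightarrow> twist N (r m n) = r (twist M m) (twist N n)"
  using r_action by (simp_all add: hom_action_def)

text \<open>Oriented so that rewriting trades a nested action for a bracket.\<close>

lemma l_r: "\<lbrakk>m \<in> carrier M; m' \<in> carrier M; n \<in> carrier N\<rbrakk> \<Longrightarrow> l (r m n) m' = \<langle>m', l n m\<rangle>\<^bsub>M\<^esub>"
  and r_l: "\<lbrakk>m \<in> carrier M; n \<in> carrier N; n' \<in> carrier N\<rbrakk> \<Longrightarrow> r (l n m) n' = \<langle>n', r m n\<rangle>\<^bsub>N\<^esub>"
  using compatible by (simp_all add: compatible_actions_def)

text \<open>Relation (iii) leads to the bracket of \<open>l n m\<close> with itself, so vanishing on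
  the diagonal is required in every characteristic.\<close>

lemma M_self: "x \<in> carrier M \<Longrightarrow> \<langle>x, x\<rangle>\<^bsub>M\<^esub> = \<zero>\<^bsub>M\<^esub>"
  using M.bracket_self char2 by blast

lemma N_self: "x \<in> carrier N \<Longrightarrow> \<langle>x, x\<rangle>\<^bsub>N\<^esub> = \<zero>\<^bsub>N\<^esub>"
  using N.bracket_self char2 by blast

section \<open>The quotient \<open>T\<close> and its universal property\<close>

sublocale X: module K X
  by (rule tensor.tensor_space_module)

lemma pure_closed [simp]: "\<lbrakk>m \<in> carrier M; n \<in> carrier N\<rbrakk> \<Longrightarrow> pt m n \<in> carrier X"
  using tensor.pure_tensor_bilinear by (auto simp: bilinear_map_def linear_map_def)

lemma star_relations_closed: "star_relations K M N l r \<subseteq> carrier X"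
  unfolding star_relations_def Let_def by auto

lemma star_kernel_submodule: "submodule (star_kernel K M N l r) K X"
  unfolding star_kernel_def by (rule X.span_submodule[OF star_relations_closed])

sublocale T: module K T
  unfolding star_space_def by (rule X.quotient_module[OF star_kernel_submodule])

lemma star_quotient_linear:
  "linear K X T (\<lambda>x. star_kernel K M N l r +>\<^bsub>X\<^esub> x)"
  unfolding star_space_def
  by (intro linear.intro linear_axioms.intro X.module_axioms
      X.quotient_map_linear[OF star_kernel_submodule] X.quotient_module[OF star_kernel_submodule])

lemma star_map_star: "star_map T s"
proof -
  let ?p = "\<lambda>x. star_kernel K M N l r +>\<^bsub>X\<^esub> x"
  interpret p: linear K X T ?p by (rule star_quotient_linear)
  have s: "s m n = ?p (pt m n)" for m n by (simp add: star_def)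
  have "bilinear_map K M N T s"
    unfolding s[abs_def]
    by (rule bilinear_map_linear_comp[OF tensor.pure_tensor_bilinear p.linear_map])
  \<comment> \<open>Each of the five identities arises in the same way: a generator of
    \<open>star_kernel\<close> has class zero, and linearity of \<open>?p\<close> splits that class
    into classes of pure tensors.\<close>
  moreover have rel: "?p x = \<zero>\<^bsub>T\<^esub>" if "x \<in> star_relations K M N l r" for x
    using X.quotient_map_kernel[OF star_kernel_submodule, of x] subsetD[OF X.span_superset that]
    by (simp add: star_space_def star_kernel_def)
  have "?p (pt \<langle>m, m'\<rangle>\<^bsub>M\<^esub> (twist N n) \<ominus>\<^bsub>X\<^esub> pt (twist M m) (r m' n) \<oplus>\<^bsub>X\<^esub> pt (twist M m') (r m n)) = \<zero>\<^bsub>T\<^esub>"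
    if "m \<in> carrier M" "m' \<in> carrier M" "n \<in> carrier N" for m m' n
    by (rule rel) (use that in \<open>unfold star_relations_def Let_def, blast\<close>)
  moreover have "?p (pt (twist M m) \<langle>n, n'\<rangle>\<^bsub>N\<^esub> \<ominus>\<^bsub>X\<^esub> pt (l n' m) (twist N n) \<oplus>\<^bsub>X\<^esub> pt (l n m) (twist N n')) = \<zero>\<^bsub>T\<^esub>"
    if "m \<in> carrier M" "n \<in> carrier N" "n' \<in> carrier N" for m n n'
    by (rule rel) (use that in \<open>unfold star_relations_def Let_def, blast\<close>)
  moreover have "?p (pt (l n m) (r m n)) = \<zero>\<^bsub>T\<^esub>"
    if "m \<in> carrier M" "n \<in> carrier N" for m n
    by (rule rel) (use that in \<open>unfold star_relations_def Let_def, blast\<close>)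
  moreover have "?p (pt (l n m) (r m' n') \<oplus>\<^bsub>X\<^esub> pt (l n' m') (r m n)) = \<zero>\<^bsub>T\<^esub>"
    if "m \<in> carrier M" "m' \<in> carrier M" "n \<in> carrier N" "n' \<in> carrier N" for m m' n n'
    by (rule rel) (use that in \<open>unfold star_relations_def Let_def, blast\<close>)
  moreover have "?p (pt \<langle>l n m, l n' m'\<rangle>\<^bsub>M\<^esub> (twist N (r m'' n''))
        \<oplus>\<^bsub>X\<^esub> pt \<langle>l n' m', l n'' m''\<rangle>\<^bsub>M\<^esub> (twist N (r m n))
        \<oplus>\<^bsub>X\<^esub> pt \<langle>l n'' m'', l n m\<rangle>\<^bsub>M\<^esub> (twist N (r m' n'))) = \<zero>\<^bsub>T\<^esub>"
    if "m \<in> carrier M" "m' \<in> carrier M" "m'' \<in> carrier M"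
      "n \<in> carrier N" "n' \<in> carrier N" "n'' \<in> carrier N" for m m' m'' n n' n''
    by (rule rel) (use that in \<open>unfold star_relations_def Let_def, blast\<close>)
  ultimately show ?thesis
    by (simp add: star_map_def s p.map_add p.map_diff)
qed

lemma star_bilinear: "bilinear_map K M N T s"
  using star_map_star by (simp add: star_map_def)

lemma star_closed [simp]: "\<lbrakk>m \<in> carrier M; n \<in> carrier N\<rbrakk> \<Longrightarrow> s m n \<in> carrier T"
  using star_bilinear by (auto simp: bilinear_map_def linear_map_def)

abbreviation "stars \<equiv> {s m n |m n. m \<in> carrier M \<and> n \<in> carrier N}"

lemma stars_closed: "stars \<subseteq> carrier T"
  by auto

lemma star_span: "carrier T \<subseteq> subspace_span K T stars"
proof -
  have eq: "(\<lambda>x. star_kernel K M N l r +>\<^bsub>X\<^esub> x) ` {pt m n |m n. m \<in> carrier M \<and> n \<in> carrier N} = stars"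
    by (auto simp: star_def)
  have sub: "{pt m n |m n. m \<in> carrier M \<and> n \<in> carrier N} \<subseteq> carrier X"
    by auto
  show ?thesis
    using X.quotient_span[OF star_kernel_submodule tensor.tensor_span sub]
    unfolding eq star_space_def .
qed

text \<open>The conditions in \<open>star_map\<close> say that the lift of \<open>f\<close> to the
  tensor product vanishes on the generators of \<open>star_kernel\<close>. The existential form
  serves to resolve the choice operators in \<open>star_twist\<close>, \<open>to_M\<close> and
  \<open>to_N\<close>.\<close>

lemma star_lift:
  assumes U: "module K U" and f: "star_map U f"
  shows "\<exists>g. linear K T U g \<and> (\<forall>m\<in>carrier M. \<forall>n\<in>carrier N. g (s m n) = f m n)"
proof -
  interpret U: module K U by (rule U)
  obtain h where h: "linear_map K X U h"
    and h_pure: "\<And>m n. \<lbrakk>m \<in> carrier M; n \<in> carrier N\<rbrakk> \<Longrightarrow> h (pt m n) = f m n"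
    by (rule tensor.tensor_lift[OF U, of f]) (use f in \<open>auto simp: star_map_def\<close>)
  interpret h: linear K X U h
    by (intro linear.intro linear_axioms.intro X.module_axioms U h)
  have "h x = \<zero>\<^bsub>U\<^esub>" if "x \<in> star_relations K M N l r" for x
    using that f unfolding star_relations_def Let_def star_map_def
    by (elim UnE CollectE exE conjE) (simp_all add: h.map_add h.map_diff h_pure)
  then have "h x = \<zero>\<^bsub>U\<^esub>" if "x \<in> star_kernel K M N l r" for x
    using that h.vanishes_on_span[OF star_relations_closed] by (simp add: star_kernel_def)
  then obtain g where g_linear: "linear_map K T U g"
    and g: "\<And>x. x \<in> carrier X \<Longrightarrow> g (star_kernel K M N l r +>\<^bsub>X\<^esub> x) = h x"
    using X.quotient_lift[OF star_kernel_submodule h.linear_axioms] star_space_def by metis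
  have "g (s m n) = f m n" if "m \<in> carrier M" "n \<in> carrier N" for m n
    using that by (simp add: star_def g h_pure)
  moreover have "linear K T U g"
    by (intro linear.intro linear_axioms.intro T.module_axioms U g_linear)
  ultimately show ?thesis by blast
qed

text \<open>Oriented to absorb a minus sign, which terminates; \<open>bracket_skew\<close> as a
  rewrite rule would apply again to its own right-hand side.\<close>

lemma M_skew: "\<lbrakk>x \<in> carrier M; y \<in> carrier M\<rbrakk> \<Longrightarrow> \<ominus>\<^bsub>M\<^esub> \<langle>x, y\<rangle>\<^bsub>M\<^esub> = \<langle>y, x\<rangle>\<^bsub>M\<^esub>"
  using M.bracket_skew[of y x] by simp

lemma N_skew: "\<lbrakk>x \<in> carrier N; y \<in> carrier N\<rbrakk> \<Longrightarrow> \<ominus>\<^bsub>N\<^esub> \<langle>x, y\<rangle>\<^bsub>N\<^esub> = \<langle>y, x\<rangle>\<^bsub>N\<^esub>"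
  using N.bracket_skew[of y x] by simp

section \<open>Both actions satisfy the relations of the tensor product\<close>

lemma l_twist_r:
  assumes "x \<in> carrier M" "m \<in> carrier M" "n \<in> carrier N"
  shows "l (twist N (r m n)) x = \<langle>x, twist M (l n m)\<rangle>\<^bsub>M\<^esub>"
  using assms by (simp add: twist_r l_r twist_l)

text \<open>By compatibility the bracket of \<open>l n m\<close> and \<open>l n' m'\<close> is again
  an action value, that of \<open>r m' n'\<close> on \<open>l n m\<close>. So \<open>r_l\<close>
  applies twice, and the factors come out in reversed order.\<close>

lemma r_bracket_l:
  assumes "x \<in> carrier N" "m \<in> carrier M" "n \<in> carrier N" "m' \<in> carrier M" "n' \<in> carrier N"
  shows "r \<langle>l n m, l n' m'\<rangle>\<^bsub>M\<^esub> x = \<langle>x, \<langle>r m' n', r m n\<rangle>\<^bsub>N\<^esub>\<rangle>\<^bsub>N\<^esub>"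
proof -
  have "\<langle>l n m, l n' m'\<rangle>\<^bsub>M\<^esub> = l (r m' n') (l n m)"
    using assms by (simp add: l_r)
  then show ?thesis
    using assms by (simp add: r_l)
qed

text \<open>Here (i) is the derivation rule and (ii) the rule for acting by a bracket. The minus
  sign is put in for the sake of \<open>to_M_bracket\<close>.\<close>

lemma star_map_l: "star_map M (\<lambda>m n. \<ominus>\<^bsub>M\<^esub> l n m)"
proof -
  have "bilinear_map K M N M (\<lambda>m n. l n m)"
    using l_bilinear by (simp add: bilinear_map_def)
  then have "bilinear_map K M N M (\<lambda>m n. \<ominus>\<^bsub>M\<^esub> l n m)"
    by (rule M.L.bilinear_map_minus)
  moreover have "\<ominus>\<^bsub>M\<^esub> l (twist N n) \<langle>m, m'\<rangle>\<^bsub>M\<^esub> \<ominus>\<^bsub>M\<^esub> \<ominus>\<^bsub>M\<^esub> l (r m' n) (twist M m)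
      \<oplus>\<^bsub>M\<^esub> \<ominus>\<^bsub>M\<^esub> l (r m n) (twist M m') = \<zero>\<^bsub>M\<^esub>"
    if "m \<in> carrier M" "m' \<in> carrier M" "n \<in> carrier N" for m m' n
  proof -
    \<comment> \<open>These are the two terms of the derivation rule. By \<open>l_r\<close> and
      skew-symmetry the second and third terms of (i) are \<open>?B\<close> and
      \<open>?A\<close>.\<close>
    let ?A = "\<langle>l n m, twist M m'\<rangle>\<^bsub>M\<^esub>" and ?B = "\<langle>twist M m, l n m'\<rangle>\<^bsub>M\<^esub>"
    have "?A \<in> carrier M" "?B \<in> carrier M" using that by auto
    then have "\<ominus>\<^bsub>M\<^esub> (?A \<oplus>\<^bsub>M\<^esub> ?B) \<oplus>\<^bsub>M\<^esub> ?B \<oplus>\<^bsub>M\<^esub> ?A = \<zero>\<^bsub>M\<^esub>"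
      using M.L.M.l_neg[of "?A \<oplus>\<^bsub>M\<^esub> ?B"]
      by (simp add: M.L.M.a_assoc M.L.M.a_comm[of ?B ?A])
    then show ?thesis
      using that by (simp add: l_derivation l_r M_skew a_minus_def)
  qed
  moreover have "\<ominus>\<^bsub>M\<^esub> l \<langle>n, n'\<rangle>\<^bsub>N\<^esub> (twist M m) \<ominus>\<^bsub>M\<^esub> \<ominus>\<^bsub>M\<^esub> l (twist N n) (l n' m)
      \<oplus>\<^bsub>M\<^esub> \<ominus>\<^bsub>M\<^esub> l (twist N n') (l n m) = \<zero>\<^bsub>M\<^esub>"
    if "m \<in> carrier M" "n \<in> carrier N" "n' \<in> carrier N" for m n n'
  proof -
    let ?A = "l (twist N n) (l n' m)" and ?B = "l (twist N n') (l n m)"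
    have "?A \<in> carrier M" "?B \<in> carrier M" using that by auto
    then have "\<ominus>\<^bsub>M\<^esub> (?A \<ominus>\<^bsub>M\<^esub> ?B) \<oplus>\<^bsub>M\<^esub> ?A \<oplus>\<^bsub>M\<^esub> \<ominus>\<^bsub>M\<^esub> ?B = \<zero>\<^bsub>M\<^esub>"
      by (simp add: a_minus_def M.L.M.a_assoc M.L.M.l_neg)
    then show ?thesis
      using that by (simp add: l_bracket a_minus_def)
  qed
  moreover have "\<ominus>\<^bsub>M\<^esub> l (r m n) (l n m) = \<zero>\<^bsub>M\<^esub>" if "m \<in> carrier M" "n \<in> carrier N" for m n
    using that by (simp add: l_r M_self)
  moreover have "\<ominus>\<^bsub>M\<^esub> l (r m' n') (l n m) \<oplus>\<^bsub>M\<^esub> \<ominus>\<^bsub>M\<^esub> l (r m n) (l n' m') = \<zero>\<^bsub>M\<^esub>"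
    if "m \<in> carrier M" "m' \<in> carrier M" "n \<in> carrier N" "n' \<in> carrier N" for m m' n n'
    using that M.L.M.l_neg[of "\<langle>l n m, l n' m'\<rangle>\<^bsub>M\<^esub>"]
    by (simp add: l_r M_skew[of "l n' m'" "l n m"])
  moreover have "\<ominus>\<^bsub>M\<^esub> l (twist N (r m'' n'')) \<langle>l n m, l n' m'\<rangle>\<^bsub>M\<^esub>
        \<oplus>\<^bsub>M\<^esub> \<ominus>\<^bsub>M\<^esub> l (twist N (r m n)) \<langle>l n' m', l n'' m''\<rangle>\<^bsub>M\<^esub>
        \<oplus>\<^bsub>M\<^esub> \<ominus>\<^bsub>M\<^esub> l (twist N (r m' n')) \<langle>l n'' m'', l n m\<rangle>\<^bsub>M\<^esub> = \<zero>\<^bsub>M\<^esub>"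
    if "m \<in> carrier M" "m' \<in> carrier M" "m'' \<in> carrier M"
      "n \<in> carrier N" "n' \<in> carrier N" "n'' \<in> carrier N" for m m' m'' n n' n''
    \<comment> \<open>By \<open>l_twist_r\<close> and skew-symmetry each summand has the shape
      [\<alpha>(x), [y, z]]. With these arguments the three summands are those of the Hom-Jacobi
      identity up to order.\<close>
    using that M.hom_jacobi[of "l n'' m''" "l n m" "l n' m'"]
    by (simp add: l_twist_r M_skew M.L.M.a_ac)
  ultimately show ?thesis by (simp add: star_map_def)
qed

text \<open>The roles are exchanged: (i) is now the rule for acting by a bracket and (ii) the
  derivation rule.\<close>

lemma star_map_r: "star_map N r"
proof -
  have "r \<langle>m, m'\<rangle>\<^bsub>M\<^esub> (twist N n) \<ominus>\<^bsub>N\<^esub> r (twist M m) (r m' n) \<oplus>\<^bsub>N\<^esub> r (twist M m') (r m n) = \<zero>\<^bsub>N\<^esub>"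
    if "m \<in> carrier M" "m' \<in> carrier M" "n \<in> carrier N" for m m' n
  proof -
    let ?A = "r (twist M m) (r m' n)" and ?B = "r (twist M m') (r m n)"
    have "?A \<in> carrier N" "?B \<in> carrier N" using that by auto
    then have "?A \<ominus>\<^bsub>N\<^esub> ?B \<ominus>\<^bsub>N\<^esub> ?A \<oplus>\<^bsub>N\<^esub> ?B = \<zero>\<^bsub>N\<^esub>"
      by (simp add: a_minus_def N.L.M.a_assoc N.L.M.a_comm[of "\<ominus>\<^bsub>N\<^esub> ?A" ?B]
          N.L.M.r_neg1 N.L.M.r_neg)
    then show ?thesis
      using that by (simp add: r_bracket)
  qed
  moreover have "r (twist M m) \<langle>n, n'\<rangle>\<^bsub>N\<^esub> \<ominus>\<^bsub>N\<^esub> r (l n' m) (twist N n) \<oplus>\<^bsub>N\<^esub> r (l n m) (twist N n') = \<zero>\<^bsub>N\<^esub>"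
    if "m \<in> carrier M" "n \<in> carrier N" "n' \<in> carrier N" for m n n'
  proof -
    let ?A = "\<langle>r m n, twist N n'\<rangle>\<^bsub>N\<^esub>" and ?B = "\<langle>twist N n, r m n'\<rangle>\<^bsub>N\<^esub>"
    have "?A \<in> carrier N" "?B \<in> carrier N" using that by auto
    then have "?A \<oplus>\<^bsub>N\<^esub> ?B \<ominus>\<^bsub>N\<^esub> ?B \<oplus>\<^bsub>N\<^esub> \<ominus>\<^bsub>N\<^esub> ?A = \<zero>\<^bsub>N\<^esub>"
      by (simp add: a_minus_def N.L.M.a_assoc N.L.M.r_neg)
    then show ?thesis
      using that by (simp add: r_derivation r_l N_skew)
  qed
  moreover have "r (l n m) (r m n) = \<zero>\<^bsub>N\<^esub>" if "m \<in> carrier M" "n \<in> carrier N" for m n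
    using that by (simp add: r_l N_self)
  moreover have "r (l n m) (r m' n') \<oplus>\<^bsub>N\<^esub> r (l n' m') (r m n) = \<zero>\<^bsub>N\<^esub>"
    if "m \<in> carrier M" "m' \<in> carrier M" "n \<in> carrier N" "n' \<in> carrier N" for m m' n n'
    using that N.L.M.r_neg[of "\<langle>r m' n', r m n\<rangle>\<^bsub>N\<^esub>"]
    by (simp add: r_l N_skew)
  moreover have "r \<langle>l n m, l n' m'\<rangle>\<^bsub>M\<^esub> (twist N (r m'' n''))
        \<oplus>\<^bsub>N\<^esub> r \<langle>l n' m', l n'' m''\<rangle>\<^bsub>M\<^esub> (twist N (r m n))
        \<oplus>\<^bsub>N\<^esub> r \<langle>l n'' m'', l n m\<rangle>\<^bsub>M\<^esub> (twist N (r m' n')) = \<zero>\<^bsub>N\<^esub>"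
    if "m \<in> carrier M" "m' \<in> carrier M" "m'' \<in> carrier M"
      "n \<in> carrier N" "n' \<in> carrier N" "n'' \<in> carrier N" for m m' m'' n n' n''
    \<comment> \<open>Compared with \<open>star_map_l\<close> the last two arguments are swapped,
      because \<open>r_bracket_l\<close> reverses the inner bracket.\<close>
    using that N.hom_jacobi[of "r m'' n''" "r m' n'" "r m n"]
    by (simp add: r_bracket_l N.L.M.a_ac)
  ultimately show ?thesis using r_bilinear by (simp add: star_map_def)
qed

text \<open>The twists preserve brackets and commute with both actions, so each identity for the
  twisted map is the corresponding identity of \<open>star_map_star\<close> at twisted
  arguments.\<close>

lemma star_map_twist: "star_map T (\<lambda>m n. s (twist M m) (twist N n))"
proof -
  have "bilinear_map K M N T (\<lambda>m n. s (twist M m) (twist N n))"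
    by (rule bilinear_map_compose[OF star_bilinear M.twist_linear N.twist_linear])
  then show ?thesis
    using star_map_star
    by (simp add: star_map_def M.twist_bracket N.twist_bracket twist_l twist_r)
qed

section \<open>Bracket and twist of the tensor product, and its maps to \<open>M\<close> and
  \<open>N\<close>\<close>

abbreviation "P \<equiv> star_product K M N l r"

lemma P_simps [simp]:
  "carrier P = carrier T" "add P = add T" "zero P = zero T" "smult P = smult T"
  "bracket P = star_bracket K M N l r" "twist P = star_twist K M N l r"
  by (simp_all add: star_product_def Let_def)

lemma P_module: "module K P"
proof (rule moduleI[OF module.axioms(1)[OF T.module_axioms] abelian_groupI])
  fix x assume "x \<in> carrier P"
  then show "\<exists>y\<in>carrier P. y \<oplus>\<^bsub>P\<^esub> x = \<zero>\<^bsub>P\<^esub>"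
    by (intro bexI[of _ "\<ominus>\<^bsub>T\<^esub> x"]) (simp_all add: T.M.l_neg)
qed (simp_all add: T.M.a_ac T.smult_l_distr T.smult_r_distr T.smult_assoc1)

lemma twist_P:
  shows "linear_map K T T (twist P)"
    and "\<lbrakk>m \<in> carrier M; n \<in> carrier N\<rbrakk> \<Longrightarrow> twist P (s m n) = s (twist M m) (twist N n)"
proof -
  have "\<exists>g. linear_map K T T g \<and> (\<forall>m\<in>carrier M. \<forall>n\<in>carrier N. g (s m n) = s (twist M m) (twist N n))"
    using star_lift[OF T.module_axioms star_map_twist] linear.linear_map by fast
  then have "linear_map K T T (twist P) \<and>
      (\<forall>m\<in>carrier M. \<forall>n\<in>carrier N. twist P (s m n) = s (twist M m) (twist N n))"
    unfolding P_simps star_twist_def Let_def by (rule someI_ex)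
  then show "linear_map K T T (twist P)"
    and "\<lbrakk>m \<in> carrier M; n \<in> carrier N\<rbrakk> \<Longrightarrow> twist P (s m n) = s (twist M m) (twist N n)"
    by blast+
qed

text \<open>The map \<phi> of the overview; \<open>to_N\<close> is \<psi>. Only values on generators
  are prescribed, and by \<open>star_span\<close> these fix a linear map on
  \<open>carrier T\<close>.\<close>

definition to_M :: "('a \<times> 'b \<Rightarrow> 'k) set set \<Rightarrow> 'a" where
  "to_M = (SOME g. linear K T M g \<and> (\<forall>m\<in>carrier M. \<forall>n\<in>carrier N. g (s m n) = \<ominus>\<^bsub>M\<^esub> l n m))"

definition to_N :: "('a \<times> 'b \<Rightarrow> 'k) set set \<Rightarrow> 'b" where
  "to_N = (SOME g. linear K T N g \<and> (\<forall>m\<in>carrier M. \<forall>n\<in>carrier N. g (s m n) = r m n))"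

lemma to_M_spec: "linear K T M to_M \<and> (\<forall>m\<in>carrier M. \<forall>n\<in>carrier N. to_M (s m n) = \<ominus>\<^bsub>M\<^esub> l n m)"
  unfolding to_M_def
  by (rule someI_ex[OF star_lift[OF M.L.module_axioms star_map_l]])

lemma to_N_spec: "linear K T N to_N \<and> (\<forall>m\<in>carrier M. \<forall>n\<in>carrier N. to_N (s m n) = r m n)"
  unfolding to_N_def
  by (rule someI_ex[OF star_lift[OF N.L.module_axioms star_map_r]])

sublocale to_M: linear K T M to_M
  using to_M_spec by blast

sublocale to_N: linear K T N to_N
  using to_N_spec by blast

lemma to_M_star: "\<lbrakk>m \<in> carrier M; n \<in> carrier N\<rbrakk> \<Longrightarrow> to_M (s m n) = \<ominus>\<^bsub>M\<^esub> l n m"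
  and to_N_star: "\<lbrakk>m \<in> carrier M; n \<in> carrier N\<rbrakk> \<Longrightarrow> to_N (s m n) = r m n"
  using to_M_spec to_N_spec by blast+

lemma star_eq_on_span:
  assumes "linear_map K T U f" and "linear_map K T U g" and "module K U"
    and "\<And>m n. \<lbrakk>m \<in> carrier M; n \<in> carrier N\<rbrakk> \<Longrightarrow> f (s m n) = g (s m n)"
    and "t \<in> carrier T"
  shows "f t = g t"
proof (rule linear_eq_on_span[OF _ _ star_span stars_closed _ assms(5)])
  show "linear K T U f" "linear K T U g"
    by (rule linearI[OF T.module_axioms assms(3)], rule assms)+
qed (use assms(4) in blast)

lemma star_minus:
  assumes "m \<in> carrier M" "n \<in> carrier N"
  shows "s (\<ominus>\<^bsub>M\<^esub> m) n = \<ominus>\<^bsub>T\<^esub> s m n"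
proof -
  interpret f: linear K M T "\<lambda>m. s m n"
    by (rule linearI[OF M.L.module_axioms T.module_axioms bilinear_mapD(2)[OF star_bilinear assms(2)]])
  show ?thesis using f.map_minus[OF assms(1)] .
qed

lemma to_M_to_N_bilinear: "bilinear_map K T T T (\<lambda>t t'. s (to_M t) (to_N t'))"
  by (rule bilinear_map_compose[OF star_bilinear to_M.linear_map to_N.linear_map])

text \<open>Uniqueness one variable at a time: with a generator in the first place the equality
  extends to all second arguments, and then to all first ones.\<close>

lemma bilinear_star_eq:
  assumes b: "bilinear_map K T T U b" and c: "bilinear_map K T T U c" and U: "module K U"
    and eq: "\<And>m n m' n'. \<lbrakk>m \<in> carrier M; n \<in> carrier N; m' \<in> carrier M; n' \<in> carrier N\<rbrakk> \<Longrightarrow>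
      b (s m n) (s m' n') = c (s m n) (s m' n')"
    and t: "t \<in> carrier T" and t': "t' \<in> carrier T"
  shows "b t t' = c t t'"
proof -
  have "b (s m n) t' = c (s m n) t'" if "m \<in> carrier M" "n \<in> carrier N" for m n
    by (rule star_eq_on_span[OF bilinear_mapD(1)[OF b star_closed[OF that]]
          bilinear_mapD(1)[OF c star_closed[OF that]] U eq[OF that] t'])
  then show ?thesis
    by (rule star_eq_on_span[OF bilinear_mapD(2)[OF b t'] bilinear_mapD(2)[OF c t'] U _ t])
qed

lemma bracket_P:
  assumes "t \<in> carrier T" "t' \<in> carrier T"
  shows "\<langle>t, t'\<rangle>\<^bsub>P\<^esub> = s (to_M t) (to_N t')"
proof -
  let ?Q = "\<lambda>b. bilinear_map K T T T b \<and>
        (\<forall>m\<in>carrier M. \<forall>n\<in>carrier N. \<forall>m'\<in>carrier M. \<forall>n'\<in>carrier N.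
           b (s m n) (s m' n') = \<ominus>\<^bsub>T\<^esub> s (l n m) (r m' n'))"
  \<comment> \<open>This is the witness for the choice in \<open>star_bracket\<close>. The minus
    sign of \<open>to_M\<close> becomes the prescribed one because \<open>s\<close> is linear in its
    first argument.\<close>
  have "?Q (\<lambda>t t'. s (to_M t) (to_N t'))"
    using to_M_to_N_bilinear by (simp add: to_M_star to_N_star star_minus)
  then have Q: "?Q (bracket P)"
    unfolding P_simps star_bracket_def Let_def by (rule someI[of ?Q])
  show ?thesis
  proof (rule bilinear_star_eq[OF conjunct1[OF Q] to_M_to_N_bilinear T.module_axioms _ assms])
    fix m n m' n'
    assume mn: "m \<in> carrier M" "n \<in> carrier N" "m' \<in> carrier M" "n' \<in> carrier N"
    then have "\<langle>s m n, s m' n'\<rangle>\<^bsub>P\<^esub> = \<ominus>\<^bsub>T\<^esub> s (l n m) (r m' n')"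
      using conjunct2[OF Q] by blast
    then show "\<langle>s m n, s m' n'\<rangle>\<^bsub>P\<^esub> = s (to_M (s m n)) (to_N (s m' n'))"
      using mn by (simp add: to_M_star to_N_star star_minus)
  qed
qed

text \<open>This is relation (iv), extended from the generators by bilinearity. It carries
  centrality of the kernel of \<open>to_M\<close> over to the second argument.\<close>

lemma bracket_P_skew:
  assumes "t \<in> carrier T" "t' \<in> carrier T"
  shows "\<langle>t, t'\<rangle>\<^bsub>P\<^esub> = \<ominus>\<^bsub>T\<^esub> \<langle>t', t\<rangle>\<^bsub>P\<^esub>"
proof -
  have "bilinear_map K T T T (\<lambda>t t'. s (to_M t') (to_N t))"
    using to_M_to_N_bilinear by (simp add: bilinear_map_def)
  then have "bilinear_map K T T T (\<lambda>t t'. \<ominus>\<^bsub>T\<^esub> s (to_M t') (to_N t))"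
    by (rule T.bilinear_map_minus)
  then have "s (to_M t) (to_N t') = \<ominus>\<^bsub>T\<^esub> s (to_M t') (to_N t)"
  proof (rule bilinear_star_eq[OF to_M_to_N_bilinear _ T.module_axioms _ assms])
    fix m n m' n'
    assume mn: "m \<in> carrier M" "n \<in> carrier N" "m' \<in> carrier M" "n' \<in> carrier N"
    then have "s (l n m) (r m' n') \<oplus>\<^bsub>T\<^esub> s (l n' m') (r m n) = \<zero>\<^bsub>T\<^esub>"
      using star_map_star by (simp add: star_map_def)
    then have "\<ominus>\<^bsub>T\<^esub> s (l n m) (r m' n') = s (l n' m') (r m n)"
      using mn by (intro T.M.minus_equality) (simp_all add: T.M.a_comm)
    then show "s (to_M (s m n)) (to_N (s m' n')) = \<ominus>\<^bsub>T\<^esub> s (to_M (s m' n')) (to_N (s m n))"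
      using mn by (simp add: to_M_star to_N_star star_minus)
  qed
  then show ?thesis using assms by (simp only: bracket_P)
qed

text \<open>On generators, compatibility turns the action of \<open>r m' n'\<close> on
  \<open>to_M (s m n)\<close> into the bracket with \<open>l n' m'\<close>. The outer minus of
  \<open>to_M\<close> then moves into that second entry and makes it
  \<open>to_M (s m' n')\<close>.\<close>

lemma to_M_bracket:
  assumes "t \<in> carrier T" "t' \<in> carrier T"
  shows "to_M \<langle>t, t'\<rangle>\<^bsub>P\<^esub> = \<langle>to_M t, to_M t'\<rangle>\<^bsub>M\<^esub>"
  unfolding bracket_P[OF assms]
proof (rule bilinear_star_eq[OF bilinear_map_linear_comp[OF to_M_to_N_bilinear to_M.linear_map]
        bilinear_map_compose[OF M.bracket_bilinear to_M.linear_map to_M.linear_map]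
        M.L.module_axioms _ assms])
  fix m n m' n'
  assume mn: "m \<in> carrier M" "n \<in> carrier N" "m' \<in> carrier M" "n' \<in> carrier N"
  let ?x = "\<ominus>\<^bsub>M\<^esub> l n m"
  have x: "?x \<in> carrier M" using mn by simp
  have "to_M (s ?x (r m' n')) = \<ominus>\<^bsub>M\<^esub> l (r m' n') ?x"
    using mn by (intro to_M_star) simp_all
  also have "\<dots> = \<langle>?x, \<ominus>\<^bsub>M\<^esub> l n' m'\<rangle>\<^bsub>M\<^esub>"
    using mn x by (simp only: l_r M.bracket_minus_right l_closed)
  finally show "to_M (s (to_M (s m n)) (to_N (s m' n'))) = \<langle>to_M (s m n), to_M (s m' n')\<rangle>\<^bsub>M\<^esub>"
    using mn by (simp only: to_M_star to_N_star)
qed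

text \<open>\<open>r_l\<close> returns the two entries in reversed order; skew-symmetry cancels this
  against the minus coming from \<open>to_M\<close>.\<close>

lemma to_N_bracket:
  assumes "t \<in> carrier T" "t' \<in> carrier T"
  shows "to_N \<langle>t, t'\<rangle>\<^bsub>P\<^esub> = \<langle>to_N t, to_N t'\<rangle>\<^bsub>N\<^esub>"
  unfolding bracket_P[OF assms]
proof (rule bilinear_star_eq[OF bilinear_map_linear_comp[OF to_M_to_N_bilinear to_N.linear_map]
        bilinear_map_compose[OF N.bracket_bilinear to_N.linear_map to_N.linear_map]
        N.L.module_axioms _ assms])
  fix m n m' n'
  assume "m \<in> carrier M" "n \<in> carrier N" "m' \<in> carrier M" "n' \<in> carrier N"
  then show "to_N (s (to_M (s m n)) (to_N (s m' n'))) = \<langle>to_N (s m n), to_N (s m' n')\<rangle>\<^bsub>N\<^esub>"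
    by (simp add: to_M_star to_N_star star_minus to_N.map_minus r_l N_skew)
qed

lemma to_M_twist: "t \<in> carrier T \<Longrightarrow> to_M (twist P t) = twist M (to_M t)"
proof (rule star_eq_on_span[OF linear_map_comp[OF twist_P(1) to_M.linear_map]
      linear_map_comp[OF to_M.linear_map M.twist_linear] M.L.module_axioms])
  interpret tw: linear K M M "twist M"
    by (rule linearI[OF M.L.module_axioms M.L.module_axioms M.twist_linear])
  fix m n assume "m \<in> carrier M" "n \<in> carrier N"
  then show "to_M (twist P (s m n)) = twist M (to_M (s m n))"
    by (simp only: twist_P(2)) (simp add: to_M_star tw.map_minus twist_l)
qed

lemma to_N_twist: "t \<in> carrier T \<Longrightarrow> to_N (twist P t) = twist N (to_N t)"
proof (rule star_eq_on_span[OF linear_map_comp[OF twist_P(1) to_N.linear_map]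
      linear_map_comp[OF to_N.linear_map N.twist_linear] N.L.module_axioms])
  fix m n assume "m \<in> carrier M" "n \<in> carrier N"
  then show "to_N (twist P (s m n)) = twist N (to_N (s m n))"
    by (simp only: twist_P(2)) (simp add: to_N_star twist_r)
qed

section \<open>The action ideals as images\<close>

abbreviation "NM \<equiv> action_ideal K N M l"
abbreviation "MN \<equiv> action_ideal K M N r"

lemma carrier_T_eq: "carrier T = subspace_span K T stars"
  by (rule equalityI[OF star_span T.span_minimal[OF T.carrier_is_submodule stars_closed]])

text \<open>The sign is absorbed by - l n m = l n (- m), so \<open>to_M\<close> maps the generators
  \<open>stars\<close> onto those of \<open>NM\<close>; the image of a span is the span of the
  image.\<close>

lemma to_M_image: "to_M ` carrier T = carrier NM"
proof -
  have l_minus: "\<ominus>\<^bsub>M\<^esub> l n m = l n (\<ominus>\<^bsub>M\<^esub> m)" if "m \<in> carrier M" "n \<in> carrier N" for m n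
  proof -
    interpret ln: linear K M M "l n"
      by (rule linearI[OF M.L.module_axioms M.L.module_axioms bilinear_mapD(1)[OF l_bilinear that(2)]])
    show ?thesis using ln.map_minus that by simp
  qed
  have "to_M ` stars = {l n m |n m. n \<in> carrier N \<and> m \<in> carrier M}" (is "_ = ?S")
  proof
    show "to_M ` stars \<subseteq> ?S"
    proof
      fix y assume "y \<in> to_M ` stars"
      then obtain m n where "m \<in> carrier M" "n \<in> carrier N" "y = to_M (s m n)" by blast
      then have "y = l n (\<ominus>\<^bsub>M\<^esub> m)" "\<ominus>\<^bsub>M\<^esub> m \<in> carrier M" "n \<in> carrier N"
        by (simp_all add: to_M_star l_minus)
      then show "y \<in> ?S" by blast
    qed
    show "?S \<subseteq> to_M ` stars"
    proof
      fix y assume "y \<in> ?S"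
      then obtain n m where "n \<in> carrier N" "m \<in> carrier M" "y = l n m" by blast
      then have "y = to_M (s (\<ominus>\<^bsub>M\<^esub> m) n)" "\<ominus>\<^bsub>M\<^esub> m \<in> carrier M" "n \<in> carrier N"
        by (simp_all add: to_M_star l_minus)
      then show "y \<in> to_M ` stars" by blast
    qed
  qed
  then show ?thesis
    by (simp add: action_ideal_def carrier_T_eq to_M.image_span[OF stars_closed])
qed

lemma to_N_image: "to_N ` carrier T = carrier MN"
proof -
  have "to_N ` stars = {to_N (s m n) |m n. m \<in> carrier M \<and> n \<in> carrier N}"
    by blast
  also have "\<dots> = {r m n |m n. m \<in> carrier M \<and> n \<in> carrier N}"
    by (rule Collect_cong) (metis to_N_star)
  finally show ?thesis
    by (simp add: action_ideal_def carrier_T_eq to_N.image_span[OF stars_closed])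
qed

end

section \<open>Series along surjective morphisms and central extensions\<close>

lemma nilpotentI: "central_series K Q k S \<Longrightarrow> nilpotent K Q"
  and ncl_le: "central_series K Q k S \<Longrightarrow> ncl K Q \<le> k"
  by (auto simp: nilpotent_def ncl_def intro: Least_le)

lemma ncl_central_series: "nilpotent K Q \<Longrightarrow> \<exists>S. central_series K Q (ncl K Q) S"
  unfolding nilpotent_def ncl_def by (rule LeastI_ex)

lemma solvableI: "abelian_series K Q k S \<Longrightarrow> solvable K Q"
  and scl_le: "abelian_series K Q k S \<Longrightarrow> scl K Q \<le> k"
  by (auto simp: solvable_def scl_def intro: Least_le)

lemma scl_abelian_series: "solvable K Q \<Longrightarrow> \<exists>S. abelian_series K Q (scl K Q) S"
  unfolding solvable_def scl_def by (rule LeastI_ex)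

text \<open>Here \<open>P\<close> is the target. In the application the source \<open>Q\<close> is
  the tensor product, and the target is \<open>NM\<close> or \<open>MN\<close>, that is
  \<open>M\<close> or \<open>N\<close> with a smaller carrier.\<close>

locale hom_epi = linear K Q P f
  for K :: "('k, 'c) ring_scheme" and Q :: "('k, 'a, 'd) hom_lie_scheme"
    and P :: "('k, 'b, 'e) hom_lie_scheme" and f :: "'a \<Rightarrow> 'b" +
  assumes surj: "f ` carrier Q = carrier P"
    and map_bracket: "\<lbrakk>x \<in> carrier Q; y \<in> carrier Q\<rbrakk> \<Longrightarrow> f \<langle>x, y\<rangle>\<^bsub>Q\<^esub> = \<langle>f x, f y\<rangle>\<^bsub>P\<^esub>"
    and map_twist: "x \<in> carrier Q \<Longrightarrow> f (twist Q x) = twist P (f x)"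
    and bracket_closed: "\<lbrakk>x \<in> carrier Q; y \<in> carrier Q\<rbrakk> \<Longrightarrow> \<langle>x, y\<rangle>\<^bsub>Q\<^esub> \<in> carrier Q"
    and twist_linear: "linear_map K Q Q (twist Q)"
begin

text \<open>Surjectivity enters through the second factor of a bracket: the image must absorb all of
  \<open>P\<close>, and each element of \<open>P\<close> has the form \<open>f x\<close>.\<close>

lemma image_hom_ideal:
  assumes "hom_ideal K Q H"
  shows "hom_ideal K P (f ` H)"
proof -
  have sub: "submodule H K Q" and tw: "\<And>h. h \<in> H \<Longrightarrow> twist Q h \<in> H"
    and br: "\<And>h x. \<lbrakk>h \<in> H; x \<in> carrier Q\<rbrakk> \<Longrightarrow> \<langle>h, x\<rangle>\<^bsub>Q\<^esub> \<in> H"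
    using assms by (auto simp: hom_ideal_def)
  have H: "h \<in> carrier Q" if "h \<in> H" for h
    using V.submoduleE(1)[OF sub] that by blast
  have "twist P (f h) \<in> f ` H" if "h \<in> H" for h
    using map_twist[OF H[OF that]] tw[OF that] by (metis imageI)
  moreover have "\<langle>f h, y\<rangle>\<^bsub>P\<^esub> \<in> f ` H" if h: "h \<in> H" and y: "y \<in> carrier P" for h y
  proof -
    obtain x where x: "x \<in> carrier Q" "y = f x" using y surj by blast
    then have "\<langle>f h, y\<rangle>\<^bsub>P\<^esub> = f \<langle>h, x\<rangle>\<^bsub>Q\<^esub>" using map_bracket[OF H[OF h]] by simp
    then show ?thesis using br[OF h x(1)] by simp
  qed
  ultimately show ?thesis
    using image_submodule[OF sub] by (auto simp: hom_ideal_def)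
qed

lemma image_series:
  assumes "series K Q k S"
  shows "series K P k (\<lambda>i. f ` S i)"
  using assms map_zero surj image_hom_ideal
  by (simp add: series_def image_mono)

lemma image_commutator_subset:
  assumes "hom_ideal K Q H" and "A \<subseteq> carrier Q" "B \<subseteq> carrier Q"
    and "commutator_space K Q A B \<subseteq> H"
  shows "commutator_space K P (f ` A) (f ` B) \<subseteq> f ` H"
proof -
  have sub: "submodule H K Q" "submodule (f ` H) K P"
    using assms(1) image_submodule by (auto simp: hom_ideal_def)
  have "\<langle>f x, f y\<rangle>\<^bsub>P\<^esub> \<in> f ` H" if "x \<in> A" "y \<in> B" for x y
  proof -
    have "\<langle>x, y\<rangle>\<^bsub>Q\<^esub> \<in> H"
      using commutator_space_subset_iff[OF sub(1)] assms(4) that by blast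
    moreover have "\<langle>f x, f y\<rangle>\<^bsub>P\<^esub> = f \<langle>x, y\<rangle>\<^bsub>Q\<^esub>"
      using that assms(2,3) map_bracket by (metis subsetD)
    ultimately show ?thesis by simp
  qed
  then show ?thesis
    using commutator_space_subset_iff[OF sub(2)] by blast
qed

lemma series_subset_carrier:
  assumes "series K Q k S" "i \<le> k"
  shows "S i \<subseteq> carrier Q"
  using assms V.submoduleE(1) by (auto simp: series_def hom_ideal_def)

lemma image_central_series:
  assumes "central_series K Q k S"
  shows "central_series K P k (\<lambda>i. f ` S i)"
proof -
  have S: "series K Q k S" using assms by (simp add: central_series_def)
  have "commutator_space K P (f ` carrier Q) (f ` S i) \<subseteq> f ` S (i - 1)" if "i \<in> {1..k}" for i
    by (rule image_commutator_subset)
      (use assms that series_subset_carrier[OF S] in \<open>auto simp: central_series_def series_def\<close>)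
  then show ?thesis using image_series[OF S] surj by (simp add: central_series_def)
qed

lemma image_abelian_series:
  assumes "abelian_series K Q k S"
  shows "abelian_series K P k (\<lambda>i. f ` S i)"
proof -
  have S: "series K Q k S" using assms by (simp add: abelian_series_def)
  have "commutator_space K P (f ` S i) (f ` S i) \<subseteq> f ` S (i - 1)" if "i \<in> {1..k}" for i
    by (rule image_commutator_subset)
      (use assms that series_subset_carrier[OF S] in \<open>auto simp: abelian_series_def series_def\<close>)
  then show ?thesis using image_series[OF S] by (simp add: abelian_series_def)
qed

lemma nilpotent_image:
  assumes "nilpotent K Q"
  shows "nilpotent K P" "ncl K P \<le> ncl K Q"
proof -
  obtain S where "central_series K Q (ncl K Q) S"
    using ncl_central_series[OF assms] by blast
  from image_central_series[OF this] show "nilpotent K P" "ncl K P \<le> ncl K Q"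
    by (rule nilpotentI, rule ncl_le)
qed

lemma solvable_image:
  assumes "solvable K Q"
  shows "solvable K P" "scl K P \<le> scl K Q"
proof -
  obtain S where "abelian_series K Q (scl K Q) S"
    using scl_abelian_series[OF assms] by blast
  from image_abelian_series[OF this] show "solvable K P" "scl K P \<le> scl K Q"
    by (rule solvableI, rule scl_le)
qed

lemma ad_power:
  assumes "x \<in> carrier Q" "y \<in> carrier Q"
  shows "((\<lambda>z. \<langle>z, x\<rangle>\<^bsub>Q\<^esub>) ^^ k) y \<in> carrier Q"
    and "f (((\<lambda>z. \<langle>z, x\<rangle>\<^bsub>Q\<^esub>) ^^ k) y) = ((\<lambda>z. \<langle>z, f x\<rangle>\<^bsub>P\<^esub>) ^^ k) (f y)"
  using assms by (induction k) (simp_all add: bracket_closed map_bracket)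

lemma engel_image:
  assumes "engel k Q"
  shows "engel k P"
  unfolding engel_def
proof (intro ballI)
  fix x y assume "x \<in> carrier P" "y \<in> carrier P"
  then obtain x' y' where "x' \<in> carrier Q" "x = f x'" "y' \<in> carrier Q" "y = f y'"
    using surj by blast
  then show "((\<lambda>z. \<langle>z, x\<rangle>\<^bsub>P\<^esub>) ^^ k) y = \<zero>\<^bsub>P\<^esub>"
    using assms ad_power(2)[of x' y' k] map_zero by (simp add: engel_def)
qed

end

text \<open>Both arguments are listed because skew-symmetry is not among the axioms of
  \<open>hom_epi\<close>. The first form serves the zero ideal and the Engel step, the second the
  bottom step of a pulled-back series.\<close>

locale central_extension = hom_epi K Q P f
  for K :: "('k, 'c) ring_scheme" and Q :: "('k, 'a, 'd) hom_lie_scheme"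
    and P :: "('k, 'b, 'e) hom_lie_scheme" and f :: "'a \<Rightarrow> 'b" +
  assumes kernel_central:
    "\<lbrakk>x \<in> carrier Q; y \<in> carrier Q; f x = \<zero>\<^bsub>P\<^esub>\<rbrakk> \<Longrightarrow> \<langle>x, y\<rangle>\<^bsub>Q\<^esub> = \<zero>\<^bsub>Q\<^esub>"
    "\<lbrakk>x \<in> carrier Q; y \<in> carrier Q; f y = \<zero>\<^bsub>P\<^esub>\<rbrakk> \<Longrightarrow> \<langle>x, y\<rangle>\<^bsub>Q\<^esub> = \<zero>\<^bsub>Q\<^esub>"
begin

text \<open>Preimages are shifted by one index. For a series \<open>S\<close>, place 1 holds the
  preimage of \<open>S 0\<close>, which is the kernel of \<open>f\<close>, and the new place 0 holds
  the zero space; this accounts for the extra unit of length.\<close>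

definition pullback_series :: "(nat \<Rightarrow> 'b set) \<Rightarrow> nat \<Rightarrow> 'a set" where
  "pullback_series S i = (case i of 0 \<Rightarrow> {\<zero>\<^bsub>Q\<^esub>} | Suc j \<Rightarrow> {x \<in> carrier Q. f x \<in> S j})"

lemma pullback_series_simps [simp]:
  "pullback_series S 0 = {\<zero>\<^bsub>Q\<^esub>}"
  "pullback_series S (Suc j) = {x \<in> carrier Q. f x \<in> S j}"
  by (simp_all add: pullback_series_def)

lemma pullback_hom_ideal:
  assumes "\<And>i. i \<le> k \<Longrightarrow> hom_ideal K P (S i)" and "i \<le> Suc k"
  shows "hom_ideal K Q (pullback_series S i)"
proof (cases i)
  case 0
  interpret tw: linear K Q Q "twist Q"
    by (rule linearI[OF V.module_axioms V.module_axioms twist_linear])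
  \<comment> \<open>[0, x] = 0 is obtained from centrality, since 0 lies in the kernel of
    \<open>f\<close>.\<close>
  show ?thesis
    using 0 V.zero_submodule kernel_central(1)[OF V.M.zero_closed _ map_zero] tw.map_zero
    by (simp add: hom_ideal_def)
next
  case (Suc j)
  then have S: "hom_ideal K P (S j)" using assms by simp
  have "twist Q x \<in> carrier Q" if "x \<in> carrier Q" for x
    using twist_linear that by (auto simp: linear_map_def)
  then show ?thesis
    using S preimage_submodule[of "S j"] Suc bracket_closed
    by (auto simp: hom_ideal_def map_twist map_bracket)
qed

lemma pullback_series:
  assumes "series K P k S"
  shows "series K Q (Suc k) (pullback_series S)"
proof -
  have ideal: "hom_ideal K P (S i)" if "i \<le> k" for i
    using assms that by (simp add: series_def)
  have S: "S 0 = {\<zero>\<^bsub>P\<^esub>}" "S k = carrier P" "\<And>i. i \<in> {1..k} \<Longrightarrow> S (i - 1) \<subseteq> S i"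
    using assms by (simp_all add: series_def)
  have "pullback_series S (i - 1) \<subseteq> pullback_series S i" if i: "i \<in> {1..Suc k}" for i
  proof -
    obtain j where j: "i = Suc j" "j \<le> k" using i by (cases i) auto
    show ?thesis
    proof (cases j)
      case 0
      then show ?thesis using j S(1) map_zero by simp
    next
      case (Suc j')
      then show ?thesis using j S(3)[of j] by auto
    qed
  qed
  moreover have "pullback_series S (Suc k) = carrier Q"
    using S(2) by auto
  ultimately show ?thesis
    using pullback_hom_ideal[of k S] ideal by (simp add: series_def)
qed

text \<open>Central and abelian series are covered at once: \<open>A\<close> is the whole carrier in
  one case and the pulled-back term itself in the other. The guard in \<open>comm\<close> leaves out
  the bottom step j = 0, which a series of \<open>P\<close> says nothing about and where centrality
  of the kernel takes over.\<close>

lemma pullback_commutator_subset: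
  assumes S: "series K P k S" and j: "j \<le> k" and A: "A \<subseteq> carrier Q"
    and comm: "j \<ge> 1 \<Longrightarrow> commutator_space K P (f ` A) (S j) \<subseteq> S (j - 1)"
  shows "commutator_space K Q A (pullback_series S (Suc j)) \<subseteq> pullback_series S j"
proof -
  have sub: "submodule (pullback_series S j) K Q"
    using pullback_series[OF S] j by (simp add: series_def hom_ideal_def)
  have "\<langle>x, y\<rangle>\<^bsub>Q\<^esub> \<in> pullback_series S j"
    if x: "x \<in> A" and y: "y \<in> pullback_series S (Suc j)" for x y
  proof -
    have xy: "x \<in> carrier Q" "y \<in> carrier Q" "f y \<in> S j" using x y A by auto
    show ?thesis
    proof (cases j)
      case 0
      then show ?thesis using S xy kernel_central(2) by (simp add: series_def)
    next
      case (Suc i)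
      have sub: "submodule (S i) K P"
        using S j Suc by (simp add: series_def hom_ideal_def)
      have "commutator_space K P (f ` A) (S j) \<subseteq> S i"
        using comm Suc by simp
      then have "\<langle>f x, f y\<rangle>\<^bsub>P\<^esub> \<in> S i"
        using xy x unfolding commutator_space_subset_iff[OF sub] by blast
      then show ?thesis using Suc xy by (simp add: bracket_closed map_bracket)
    qed
  qed
  then show ?thesis
    unfolding commutator_space_subset_iff[OF sub] by blast
qed

lemma pullback_central_series:
  assumes "central_series K P k S"
  shows "central_series K Q (Suc k) (pullback_series S)"
proof -
  have S: "series K P k S" using assms by (simp add: central_series_def)
  have "commutator_space K Q (carrier Q) (pullback_series S (Suc j)) \<subseteq> pullback_series S j"
    if "j \<le> k" for j
    by (rule pullback_commutator_subset[OF S that])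
      (use assms that surj in \<open>simp_all add: central_series_def\<close>)
  then have "commutator_space K Q (carrier Q) (pullback_series S i) \<subseteq> pullback_series S (i - 1)"
    if "i \<in> {1..Suc k}" for i
    using that by (cases i) (simp_all del: pullback_series_simps)
  then show ?thesis using pullback_series[OF S] by (simp add: central_series_def)
qed

lemma pullback_abelian_series:
  assumes "abelian_series K P k S"
  shows "abelian_series K Q (Suc k) (pullback_series S)"
proof -
  have S: "series K P k S" using assms by (simp add: abelian_series_def)
  have "commutator_space K Q (pullback_series S (Suc j)) (pullback_series S (Suc j)) \<subseteq> pullback_series S j"
    if j: "j \<le> k" for j
  proof (rule pullback_commutator_subset[OF S j])
    have "S j \<subseteq> carrier P"
      using S j W.submoduleE(1) by (auto simp: series_def hom_ideal_def)
    \<comment> \<open>By surjectivity the image of the full preimage is \<open>S j\<close> itself,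
      so the commutator bound of the given series applies.\<close>
    then have "S j \<subseteq> f ` {x \<in> carrier Q. f x \<in> S j}"
      unfolding surj[symmetric] by blast
    then have image: "f ` pullback_series S (Suc j) = S j"
      by auto
    show "commutator_space K P (f ` pullback_series S (Suc j)) (S j) \<subseteq> S (j - 1)" if "j \<ge> 1"
      unfolding image using assms j that by (simp add: abelian_series_def)
  qed simp
  then have "commutator_space K Q (pullback_series S i) (pullback_series S i) \<subseteq> pullback_series S (i - 1)"
    if "i \<in> {1..Suc k}" for i
    using that by (cases i) (simp_all del: pullback_series_simps)
  then show ?thesis using pullback_series[OF S] by (simp add: abelian_series_def)
qed

lemma nilpotent_pullback:
  assumes "nilpotent K P"
  shows "nilpotent K Q" "ncl K Q \<le> ncl K P + 1"
proof -
  obtain S where "central_series K P (ncl K P) S"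
    using ncl_central_series[OF assms] by blast
  then have "central_series K Q (ncl K P + 1) (pullback_series S)"
    using pullback_central_series by simp
  then show "nilpotent K Q" "ncl K Q \<le> ncl K P + 1"
    by (rule nilpotentI, rule ncl_le)
qed

lemma solvable_pullback:
  assumes "solvable K P"
  shows "solvable K Q" "scl K Q \<le> scl K P + 1"
proof -
  obtain S where "abelian_series K P (scl K P) S"
    using scl_abelian_series[OF assms] by blast
  then have "abelian_series K Q (scl K P + 1) (pullback_series S)"
    using pullback_abelian_series by simp
  then show "solvable K Q" "scl K Q \<le> scl K P + 1"
    by (rule solvableI, rule scl_le)
qed

lemma engel_pullback:
  assumes "engel k P"
  shows "engel (k + 1) Q"
  unfolding engel_def
proof (intro ballI)
  fix x y assume xy: "x \<in> carrier Q" "y \<in> carrier Q"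
  then have "f (((\<lambda>z. \<langle>z, x\<rangle>\<^bsub>Q\<^esub>) ^^ k) y) = \<zero>\<^bsub>P\<^esub>"
    using assms by (simp add: ad_power(2) engel_def)
  \<comment> \<open>The additional factor stands outermost and brackets an element of the kernel of
    \<open>f\<close>.\<close>
  then show "((\<lambda>z. \<langle>z, x\<rangle>\<^bsub>Q\<^esub>) ^^ (k + 1)) y = \<zero>\<^bsub>Q\<^esub>"
    using kernel_central(1) ad_power(1)[OF xy] xy by simp
qed

end

section \<open>The tensor product as a central extension\<close>

lemma action_ideal_module:
  assumes I: "module K I" and act: "bilinear_map K L I I act"
  shows "module K (action_ideal K L I act)"
proof -
  interpret I: module K I by (rule I)
  have "{act x m |x m. x \<in> carrier L \<and> m \<in> carrier I} \<subseteq> carrier I"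
    using act by (auto simp: bilinear_map_def linear_map_def)
  from submodule.submodule_is_module[OF I.span_submodule[OF this] I]
  show ?thesis by (simp add: action_ideal_def)
qed

context compatible_pair
begin

text \<open>The function stays the same; its source is retyped from the bare space to the record
  with bracket and twist, and its target is cut down to the image.\<close>

lemma linear_on_P:
  assumes "linear K T W f" and "module K (W\<lparr>carrier := f ` carrier T\<rparr>)"
  shows "linear K P (W\<lparr>carrier := f ` carrier T\<rparr>) f"
proof -
  interpret f: linear K T W f by fact
  show ?thesis
    by (rule linearI[OF P_module assms(2)])
      (simp add: linear_map_def f.map_add f.map_smult)
qed

lemma P_closed:
  shows "\<lbrakk>t \<in> carrier P; t' \<in> carrier P\<rbrakk> \<Longrightarrow> \<langle>t, t'\<rangle>\<^bsub>P\<^esub> \<in> carrier P"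
    and "linear_map K P P (twist P)"
  using bracket_P twist_P(1) by (simp_all add: linear_map_def)

sublocale NM: central_extension K P NM to_M
proof -
  have NM: "NM = M\<lparr>carrier := to_M ` carrier T\<rparr>"
    using to_M_image by (simp add: action_ideal_def)
  have kernel: "\<langle>t, t'\<rangle>\<^bsub>P\<^esub> = \<zero>\<^bsub>T\<^esub>"
    if "t \<in> carrier T" "t' \<in> carrier T" "to_M t = \<zero>\<^bsub>M\<^esub>" for t t'
  proof -
    interpret z: linear K M T "\<lambda>m. s m (to_N t')"
      by (rule linearI[OF M.L.module_axioms T.module_axioms
            bilinear_mapD(2)[OF star_bilinear to_N.map_closed[OF that(2)]]])
    show ?thesis using that z.map_zero by (simp only: bracket_P)
  qed
  have kernel': "\<langle>t, t'\<rangle>\<^bsub>P\<^esub> = \<zero>\<^bsub>T\<^esub>"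
    if "t \<in> carrier T" "t' \<in> carrier T" "to_M t' = \<zero>\<^bsub>M\<^esub>" for t t'
    using bracket_P_skew[OF that(1,2)] kernel[OF that(2,1,3)] by simp
  have "linear K P NM to_M"
    using linear_on_P[OF to_M.linear_axioms] action_ideal_module[OF M.L.module_axioms l_bilinear]
    by (simp only: NM)
  then show "central_extension K P NM to_M"
    using to_M_image to_M_bracket to_M_twist P_closed kernel kernel'
    by (simp add: central_extension_def hom_epi_def hom_epi_axioms_def central_extension_axioms_def
        action_ideal_def)
qed

sublocale MN: hom_epi K P MN to_N
proof -
  have MN: "MN = N\<lparr>carrier := to_N ` carrier T\<rparr>"
    using to_N_image by (simp add: action_ideal_def)
  have "linear K P MN to_N"
    using linear_on_P[OF to_N.linear_axioms] action_ideal_module[OF N.L.module_axioms r_bilinear]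
    by (simp only: MN)
  then show "hom_epi K P MN to_N"
    using to_N_image to_N_bracket to_N_twist P_closed
    by (simp add: hom_epi_def hom_epi_axioms_def action_ideal_def)
qed

end

theorem theorem5p2:
  fixes K :: "('k, 'c) ring_scheme"
    and M :: "('k, 'a, 'd) hom_lie_scheme" and N :: "('k, 'b, 'e) hom_lie_scheme"
    and l :: "'b \<Rightarrow> 'a \<Rightarrow> 'a" and r :: "'a \<Rightarrow> 'b \<Rightarrow> 'b"
  assumes "hom_lie_algebra K M" and "hom_lie_algebra K N"
    and char2: "\<one>\<^bsub>K\<^esub> \<oplus>\<^bsub>K\<^esub> \<one>\<^bsub>K\<^esub> = \<zero>\<^bsub>K\<^esub> \<Longrightarrow> alternating M \<and> alternating N"
    and "hom_action K N M l" and "hom_action K M N r"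
    and "compatible_actions M N l r"
  shows
    "let NM = action_ideal K N M l; MN = action_ideal K M N r; T = star_product K M N l r in
       ((nilpotent K NM \<longrightarrow> nilpotent K T \<and> nilpotent K MN) \<and>
        (\<forall>k. nilpotent K NM \<and> ncl K NM = k \<longrightarrow>
           k \<le> ncl K T \<and> ncl K T \<le> k + 1 \<and> ncl K MN \<le> k + 1)) \<and>
       ((twist M ` carrier M = carrier M \<and> twist N ` carrier N = carrier N) \<or>
        (weak_alpha_identity M \<and> weak_alpha_identity N) \<longrightarrow>
          (solvable K NM \<longrightarrow> solvable K T \<and> solvable K MN) \<and>
          (\<forall>k. solvable K NM \<and> scl K NM = k \<longrightarrow>
             k \<le> scl K T \<and> scl K T \<le> k + 1 \<and> scl K MN \<le> k + 1)) \<and>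
       (\<forall>k. engel k NM \<longrightarrow> engel (k + 1) T \<and> engel (k + 1) MN)"
proof -
  interpret compatible_pair K M N l r
    using assms by (simp add: compatible_pair_def compatible_pair_axioms_def)
  \<comment> \<open>\<open>NM\<close> as an image of \<open>P\<close> gives the lower bound, the
    pullback along \<open>to_M\<close> the upper one, and \<open>MN\<close> as an image of
    \<open>P\<close> inherits the upper bound.\<close>
  have "nilpotent K P \<and> nilpotent K MN \<and> ncl K NM \<le> ncl K P \<and> ncl K P \<le> ncl K NM + 1 \<and>
      ncl K MN \<le> ncl K NM + 1" if "nilpotent K NM"
    using NM.nilpotent_pullback[OF that] NM.nilpotent_image MN.nilpotent_image
    by (meson order_trans)
  moreover have "solvable K P \<and> solvable K MN \<and> scl K NM \<le> scl K P \<and> scl K P \<le> scl K NM + 1 \<and>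
      scl K MN \<le> scl K NM + 1" if "solvable K NM"
    using NM.solvable_pullback[OF that] NM.solvable_image MN.solvable_image
    by (meson order_trans)
  moreover have "engel (k + 1) P \<and> engel (k + 1) MN" if "engel k NM" for k
    using NM.engel_pullback[OF that] MN.engel_image by blast
  ultimately show ?thesis
    unfolding Let_def by (intro conjI impI allI) (simp_all only: simp_thms)
qed

end
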